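(* Let $(X_i)_{i=1}^n$ be a sequence of $p$-dimensional random vectors such that $\mathbb{E}[X_iX_i^\top]=\Sigma$ for all $i=1,\ldots,n$, and suppose that the distribution of the $\mathbb{R}^{pn}$-valued random vector $((\Sigma^\dagger)^{1/2}X_1,\ldots,(\Sigma^\dagger)^{1/2}X_n)$ satisfies a log-Sobolev inequality with constant $K>0$. Then, for any $t\ge 0$ and positive integer $n$ satisfying $n\ge 2K(9\,\mathbf{r}(\Sigma)+4t)$, with probability at least $1-\exp(-t)$, $$\left\|\frac1n\sum_{i=1}^n X_iX_i^\top-\Sigma\right\|\le 12\sqrt{K}\,\|\Sigma\|\sqrt{\frac{9\,\mathbf{r}(\Sigma)+4t}{n}}.$$
   Context: $\|\cdot\|$ is the Euclidean norm for vectors and the $\ell^2\to\ell^2$ operator norm for matrices. $M^\dagger$ is the Moore--Penrose inverse of $M$. For a positive semi-definite matrix $M$, the effective rank is $\mathbf{r}(M)=\mathrm{Tr}(M)/\|M\|$ if $\|M\|>0$ and $\mathbf{r}(M)=0$ otherwise. A probability distribution $P$ on $\mathbb{R}^d$ satisfies a log-Sobolev inequality with constant $C>0$ if for every locally Lipschitz $f:\mathbb{R}^d\to\mathbb{R}$, $\mathrm{Ent}_P(f^2)\le 2C\int\|\nabla f\|^2\,dP$, where $\mathrm{Ent}_P(g)=\int g\log g\,dP-\int g\,dP\,\log\left(\int g\,dP\right)$ for non-negative $g$ and $\nabla$ is the gradient on $\mathbb{R}^d$. No independence of the $X_i$ is assumed. *)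

theory Defs
  imports "HOL-Probability.Probability"
begin

section \<open>Real matrices\<close>

definition outer_self :: "real ^ 'p \<Rightarrow> real ^ 'p ^ 'p" where
  "outer_self v = (\<chi> j k. v $ j * v $ k)"

definition psd :: "real ^ 'p ^ 'p \<Rightarrow> bool" where
  "psd A \<longleftrightarrow> transpose A = A \<and> (\<forall>x. 0 \<le> x \<bullet> (A *v x))"

text \<open>The Moore--Penrose inverse, by the four Penrose equations; every real matrix has exactly
  one.\<close>

definition is_mp_inverse :: "real ^ 'p ^ 'p \<Rightarrow> real ^ 'p ^ 'p \<Rightarrow> bool" where
  "is_mp_inverse A B \<longleftrightarrow>
     A ** B ** A = A \<and> B ** A ** B = B \<and>
     transpose (A ** B) = A ** B \<and> transpose (B ** A) = B ** A"

definition mp_inverse :: "real ^ 'p ^ 'p \<Rightarrow> real ^ 'p ^ 'p" where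
  "mp_inverse A = (THE B. is_mp_inverse A B)"

text \<open>The positive semi-definite square root, meaningful for positive semi-definite arguments,
  which have exactly one.\<close>

definition psd_sqrt :: "real ^ 'p ^ 'p \<Rightarrow> real ^ 'p ^ 'p" where
  "psd_sqrt A = (THE R. psd R \<and> R ** R = A)"

definition op_norm :: "real ^ 'p ^ 'p \<Rightarrow> real" where
  "op_norm A = onorm (\<lambda>x. A *v x)"

definition eff_rank :: "real ^ 'p ^ 'p \<Rightarrow> real" where
  "eff_rank A = (if op_norm A > 0 then trace A / op_norm A else 0)"


section \<open>Log-Sobolev inequality\<close>

definition locally_lipschitz :: "('a::metric_space \<Rightarrow> 'b::metric_space) \<Rightarrow> bool" where
  "locally_lipschitz f \<longleftrightarrow> (\<forall>x. \<exists>r>0. \<exists>L. L-lipschitz_on (cball x r) f)"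

definition gradient :: "('a::real_inner \<Rightarrow> real) \<Rightarrow> 'a \<Rightarrow> 'a" where
  "gradient f x = (THE g. GDERIV f x :> g)"

definition Ent :: "'a measure \<Rightarrow> ('a \<Rightarrow> real) \<Rightarrow> real" where
  "Ent P g = (\<integral>x. g x * ln (g x) \<partial>P) - (\<integral>x. g x \<partial>P) * ln (\<integral>x. g x \<partial>P)"

text \<open>
  A locally Lipschitz function need not have a gradient on a set that is null for Lebesgue measure
  but not for \<open>P\<close> (for instance when \<open>P\<close> lives on a proper subspace), so the inequality is
  required of those \<open>f\<close> whose gradient exists \<open>P\<close>-almost everywhere.

  The inequality is between extended reals: it is trivial when the right-hand side is infinite,
  the entropy is defined for \<open>P\<close>-integrable \<open>f\<^sup>2\<close>, and a finite right-hand side forces the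
  entropy to be finite.  The integrability conditions express this, as the Bochner integral
  of a non-integrable function is 0.  In \<open>Ent\<close>, \<open>0 * ln 0 = 0\<close>.
\<close>

definition log_sobolev :: "'a::euclidean_space measure \<Rightarrow> real \<Rightarrow> bool" where
  "log_sobolev P C \<longleftrightarrow>
     (\<forall>f :: 'a \<Rightarrow> real.
        locally_lipschitz f \<longrightarrow>
        (AE x in P. f differentiable (at x)) \<longrightarrow>
        integrable P (\<lambda>x. (f x)\<^sup>2) \<longrightarrow>
        integrable P (\<lambda>x. (norm (gradient f x))\<^sup>2) \<longrightarrow>
        integrable P (\<lambda>x. (f x)\<^sup>2 * ln ((f x)\<^sup>2)) \<and>
        Ent P (\<lambda>x. (f x)\<^sup>2) \<le> 2 * C * (\<integral>x. (norm (gradient f x))\<^sup>2 \<partial>P))"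

end

theory Submission
  imports Defs
begin

text \<open>
  The proof is a PAC-Bayesian argument: exponential moments in fixed directions are averaged over a Gaussian
  distribution of directions, which yields a bound uniform in the direction that depends on the dimension only
  through the effective rank.

  Fixed direction.  The sum of the squares \<open>(X i \<bullet> v)\<^sup>2\<close> is almost surely a function \<open>g\<close> of the whitened sample with
  \<open>|grad g|\<^sup>2 = 4 (v \<bullet> Sigma v) g\<close>.  For such self-bounding functions the log-Sobolev inequality becomes, by
  Herbst's argument, a differential inequality for the logarithmic Laplace transform, and integrating it gives a
  bound of Bernstein type for both signs of the parameter (\<open>mgf_self_bounding\<close>, \<open>mgf_deviation\<close>).

  All directions.  Write \<open>r\<close> for the effective rank, \<open>m\<close> for the norm of \<open>Sigma\<close> and \<open>D\<close> for the sum of the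
  \<open>X i X i\<^sup>T\<close> minus \<open>n Sigma\<close>.  Integrate the exponential of \<open>x \<bullet> D x\<close> over \<open>x\<close> against the weight
  \<open>exp (- r |x|\<^sup>2)\<close>, restricted to an ellipsoid on which \<open>x \<bullet> Sigma x\<close> is at most a multiple of \<open>m\<close>.  Its expectation
  is bounded by the fixed-direction estimate, hence the integral itself is bounded with high
  probability by Markov's inequality.  Conversely, by translating the weight by an arbitrary unit vector \<open>v\<close> and applying
  Jensen's inequality, the integral is at least the exponential of \<open>v \<bullet> D v\<close>, up to a factor \<open>exp (- r)\<close> and the
  Gaussian average of \<open>x \<bullet> D x\<close> (\<open>gauss_exponential_lower_bound\<close>).  That average does not depend on \<open>v\<close>; it is removed by a
  second mixture centred at \<open>0\<close>.  With this precision of the Gaussian the ellipsoid \<open>x \<bullet> Sigma x \<le> m\<close> carries at least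
  half of its mass (\<open>gauss_mass_ellipsoid\<close>), which is where the effective rank replaces the dimension.
  The two steps are combined in \<open>uniform_deviation\<close>, and the theorem follows by choosing the exponent.

  The linear algebra serves to give a meaning to the square root and the Moore--Penrose inverse, both defined by
  a description operator, and to pass from quadratic forms to the operator norm.
\<close>

section \<open>Spectral decomposition of symmetric matrices\<close>

lemma symmetric_inner_swap:
  fixes A :: "real ^ 'n ^ 'n"
  assumes "transpose A = A"
  shows "x \<bullet> (A *v y) = (A *v x) \<bullet> y"
  using assms by (metis dot_lmul_matrix matrix_vector_mul_linear transpose_matrix_vector)

text \<open>A maximiser \<open>b\<close> of the Rayleigh quotient on the unit sphere of the subspace is an eigenvector:
  moving from \<open>b\<close> against the direction of the residual \<open>h = l b - A b\<close>, which stays in the subspace, would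
  increase the quotient to first order unless \<open>h = 0\<close>.\<close>

lemma eigenvector_in_invariant_subspace:
  fixes A :: "real ^ 'n ^ 'n"
  assumes sym: "transpose A = A" and V: "subspace V" and inv: "\<And>x. x \<in> V \<Longrightarrow> A *v x \<in> V"
    and nz: "\<exists>x\<in>V. x \<noteq> 0"
  shows "\<exists>b l. b \<in> V \<and> norm b = 1 \<and> A *v b = l *\<^sub>R b"
proof -
  have cl: "closed V" using V by (rule closed_subspace)
  have cpt: "compact (V \<inter> sphere 0 1)" using cl by (simp add: closed_Int_compact)
  obtain x where x: "x \<in> V" "x \<noteq> 0" using nz by blast
  have "(1 / norm x) *\<^sub>R x \<in> V \<inter> sphere 0 1"
    using x V by (auto simp: subspace_scale)
  hence ne: "V \<inter> sphere 0 1 \<noteq> {}" by blast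
  have cont: "continuous_on (V \<inter> sphere 0 1) (\<lambda>x. x \<bullet> (A *v x))"
    by (rule continuous_on_inner[OF continuous_on_id matrix_vector_mult_linear_continuous_on])
  obtain b where b: "b \<in> V \<inter> sphere 0 1"
    and mx: "\<And>y. y \<in> V \<inter> sphere 0 1 \<Longrightarrow> y \<bullet> (A *v y) \<le> b \<bullet> (A *v b)"
    using continuous_attains_sup[OF cpt ne cont] by blast
  define l where "l = b \<bullet> (A *v b)"
  have bV: "b \<in> V" and nb: "norm b = 1" using b by auto
  have quad: "y \<bullet> (A *v y) \<le> l * (norm y)\<^sup>2" if "y \<in> V" for y
  proof (cases "y = 0")
    case False
    have "(1 / norm y) *\<^sub>R y \<in> V \<inter> sphere 0 1" using that False V by (auto simp: subspace_scale)
    from mx[OF this] have "(1 / norm y)\<^sup>2 * (y \<bullet> (A *v y)) \<le> l"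
      by (simp add: l_def matrix_vector_mult_scaleR power2_eq_square)
    thus ?thesis using False by (simp add: field_simps power2_eq_square)
  qed simp
  define h where "h = l *\<^sub>R b - A *v b"
  have hV: "h \<in> V" unfolding h_def using bV inv V by (simp add: subspace_diff subspace_scale)
  define k where "k = l * (norm h)\<^sup>2 - h \<bullet> (A *v h)"
  have k0: "k \<ge> 0" using quad[OF hV] by (simp add: k_def)
  \<comment> \<open>The quadratic inequality at \<open>b - e h\<close>; its terms of order zero cancel because \<open>b\<close> attains \<open>l\<close>.\<close>
  have key: "2 * e * (norm h)\<^sup>2 \<le> e\<^sup>2 * k" for e
  proof -
    have "b - e *\<^sub>R h \<in> V" using bV hV V by (simp add: subspace_diff subspace_scale)
    from quad[OF this]
    have e1: "(b - e *\<^sub>R h) \<bullet> (A *v (b - e *\<^sub>R h)) \<le> l * (norm (b - e *\<^sub>R h))\<^sup>2" .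
    have e2: "(b - e *\<^sub>R h) \<bullet> (A *v (b - e *\<^sub>R h))
        = l - 2 * e * (h \<bullet> (A *v b)) + e\<^sup>2 * (h \<bullet> (A *v h))"
      using symmetric_inner_swap[OF sym, of b h]
      by (simp add: matrix_vector_mult_diff_distrib matrix_vector_mult_scaleR inner_diff_left
          inner_diff_right l_def power2_eq_square algebra_simps inner_commute)
    have e3: "(norm (b - e *\<^sub>R h))\<^sup>2 = 1 - 2 * e * (h \<bullet> b) + e\<^sup>2 * (norm h)\<^sup>2"
    proof -
      have "b \<bullet> b = 1" using nb by (simp add: norm_eq_1)
      thus ?thesis unfolding power2_norm_eq_inner
        by (simp add: inner_diff_left inner_diff_right power2_eq_square algebra_simps inner_commute)
    qed
    have e4: "(norm h)\<^sup>2 = l * (h \<bullet> b) - h \<bullet> (A *v b)"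
      unfolding power2_norm_eq_inner by (subst (2) h_def) (simp add: inner_diff_right)
    have "2 * e * (norm h)\<^sup>2 = 2 * e * (l * (h \<bullet> b)) - 2 * e * (h \<bullet> (A *v b))"
      by (subst e4) (simp only: right_diff_distrib)
    moreover have "e\<^sup>2 * k = l * (e\<^sup>2 * (norm h)\<^sup>2) - e\<^sup>2 * (h \<bullet> (A *v h))"
      by (simp add: k_def right_diff_distrib)
    moreover have "l * (1 - 2 * e * (h \<bullet> b) + e\<^sup>2 * (norm h)\<^sup>2)
        = l - 2 * e * (l * (h \<bullet> b)) + l * (e\<^sup>2 * (norm h)\<^sup>2)"
      by (simp add: right_diff_distrib distrib_left)
    ultimately show ?thesis using e1 unfolding e2 e3 by linarith
  qed
  have "norm h = 0"
  proof (rule ccontr)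
    assume "norm h \<noteq> 0"
    hence p: "(norm h)\<^sup>2 > 0" by simp
    \<comment> \<open>So small that the quadratic term \<open>e\<^sup>2 k\<close> stays below the linear one; \<open>k\<close> may be \<open>0\<close>.\<close>
    define e where "e = (norm h)\<^sup>2 / (k + 1)"
    have e: "e > 0" using p k0 by (simp add: e_def)
    have "2 * (norm h)\<^sup>2 \<le> e * k" using key[of e] e by (simp add: power2_eq_square)
    also have "\<dots> \<le> (norm h)\<^sup>2" using k0 p by (simp add: e_def field_simps)
    finally show False using p by simp
  qed
  hence "A *v b = l *\<^sub>R b" by (simp add: h_def)
  thus ?thesis using bV nb by blast
qed

text \<open>Completeness is expressed by the reconstruction formula, the form in which it is used below.\<close>

definition orthonormal_basis :: "'a::real_inner set \<Rightarrow> bool" where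
  "orthonormal_basis B \<longleftrightarrow> finite B \<and> pairwise orthogonal B \<and> (\<forall>b\<in>B. norm b = 1) \<and>
     (\<forall>x. (\<Sum>b\<in>B. (b \<bullet> x) *\<^sub>R b) = x)"

lemma inner_orthonormal_sum:
  assumes "finite B" "pairwise orthogonal B" "\<And>b. b \<in> B \<Longrightarrow> norm b = 1" "d \<in> B"
  shows "d \<bullet> (\<Sum>b\<in>B. c b *\<^sub>R b) = c d"
proof -
  have "d \<bullet> (\<Sum>b\<in>B. c b *\<^sub>R b) = (\<Sum>b\<in>B. if b = d then c b else 0)"
    unfolding inner_sum_right
  proof (rule sum.cong[OF refl])
    fix b assume b: "b \<in> B"
    show "d \<bullet> (c b *\<^sub>R b) = (if b = d then c b else 0)"
    proof (cases "b = d")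
      case True
      have "d \<bullet> d = 1" using assms(3)[OF assms(4)] by (simp add: norm_eq_1)
      with True show ?thesis by simp
    next
      case False
      hence "d \<bullet> b = 0" using assms(2,4) b by (auto simp: pairwise_def orthogonal_def)
      with False show ?thesis by simp
    qed
  qed
  also have "\<dots> = c d" using assms by simp
  finally show ?thesis .
qed

text \<open>Take an orthonormal set of eigenvectors of maximal cardinality.  Its orthogonal complement is
  invariant, so a nonzero complement would contain a further unit eigenvector.\<close>

theorem spectral_theorem:
  fixes A :: "real ^ 'n ^ 'n"
  assumes sym: "transpose A = A"
  shows "\<exists>B l. orthonormal_basis B \<and> (\<forall>b\<in>B. A *v b = l b *\<^sub>R b)"
proof -
  define good where "good B \<longleftrightarrow> finite B \<and> pairwise orthogonal B \<and> (\<forall>b\<in>B. norm b = 1) \<and>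
    (\<forall>b\<in>B. \<exists>l. A *v b = l *\<^sub>R b)" for B :: "(real ^ 'n) set"
  have bound: "card B \<le> DIM(real ^ 'n)" if "good B" for B
  proof -
    have "independent B" using that
      by (intro pairwise_orthogonal_independent) (auto simp: good_def)
    thus ?thesis using independent_bound by blast
  qed
  have "good {}" by (simp add: good_def)
  then obtain B where B: "good B" and mx: "\<And>C. good C \<Longrightarrow> card C \<le> card B"
    using ex_has_greatest_nat[of good "{}" card "Suc (DIM(real ^ 'n))"] bound
    by (auto simp: less_Suc_eq_le)
  define V where "V = {x. \<forall>b\<in>B. b \<bullet> x = 0}"
  have sV: "subspace V" unfolding V_def by (auto simp: subspace_def inner_add_right)
  have iV: "A *v x \<in> V" if "x \<in> V" for x
    unfolding V_def
  proof (safe)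
    fix b assume b: "b \<in> B"
    then obtain l where "A *v b = l *\<^sub>R b" using B by (auto simp: good_def)
    thus "b \<bullet> (A *v x) = 0" using that b symmetric_inner_swap[OF sym, of b x] by (simp add: V_def)
  qed
  have V0: "x = 0" if x: "x \<in> V" for x
  proof (rule ccontr)
    assume "x \<noteq> 0"
    then obtain b l where b: "b \<in> V" "norm b = 1" "A *v b = l *\<^sub>R b"
      using eigenvector_in_invariant_subspace[OF sym sV iV] x by blast
    have nB: "b \<notin> B" using b by (auto simp: V_def norm_eq_1)
    have "good (insert b B)"
      using B b by (auto simp: good_def pairwise_insert V_def orthogonal_def inner_commute)
    from mx[OF this] show False using nB B by (simp add: good_def)
  qed
  have Bp: "finite B" "pairwise orthogonal B" "\<And>b. b \<in> B \<Longrightarrow> norm b = 1"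
    using B by (auto simp: good_def)
  have "(\<Sum>b\<in>B. (b \<bullet> x) *\<^sub>R b) = x" for x
  proof -
    have "x - (\<Sum>b\<in>B. (b \<bullet> x) *\<^sub>R b) \<in> V"
      unfolding V_def using inner_orthonormal_sum[OF Bp, of _ "\<lambda>b. b \<bullet> x"]
      by (simp add: inner_diff_right)
    from V0[OF this] show ?thesis by simp
  qed
  hence "orthonormal_basis B" using Bp by (simp add: orthonormal_basis_def)
  moreover have "\<exists>l. \<forall>b\<in>B. A *v b = l b *\<^sub>R b" using B unfolding good_def by metis
  ultimately show ?thesis by blast
qed

text \<open>The functional calculus of a matrix whose eigenvectors are \<open>B\<close>: it turns the identities
  between a matrix, its square root and its Moore--Penrose inverse into identities between numbers.\<close>

definition spectral_matrix :: "(real ^ 'n) set \<Rightarrow> (real ^ 'n \<Rightarrow> real) \<Rightarrow> real ^ 'n ^ 'n" where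
  "spectral_matrix B c = (\<Sum>b\<in>B. c b *\<^sub>R outer_self b)"

lemma outer_self_mult: "outer_self b *v x = (b \<bullet> x) *\<^sub>R b"
  by (simp add: outer_self_def vec_eq_iff matrix_vector_mult_def inner_vec_def sum_distrib_left
      sum_distrib_right ac_simps)

lemma matrix_vector_mult_sum_left:
  fixes F :: "'b \<Rightarrow> real ^ 'n ^ 'm"
  shows "(\<Sum>b\<in>B. F b) *v x = (\<Sum>b\<in>B. F b *v x)"
  by (induction B rule: infinite_finite_induct) (auto simp: matrix_vector_mult_add_rdistrib)

lemma spectral_matrix_mult: "spectral_matrix B c *v x = (\<Sum>b\<in>B. (c b * (b \<bullet> x)) *\<^sub>R b)"
  by (simp add: spectral_matrix_def matrix_vector_mult_sum_left outer_self_mult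
      scaleR_matrix_vector_assoc[symmetric])

lemma trace_spectral_matrix:
  assumes "orthonormal_basis B"
  shows "trace (spectral_matrix B c) = (\<Sum>b\<in>B. c b)"
proof -
  have "trace (spectral_matrix B c) = (\<Sum>b\<in>B. c b * (b \<bullet> b))"
    unfolding trace_def spectral_matrix_def outer_self_def
    by (simp add: sum_distrib_left inner_vec_def) (rule sum.swap)
  also have "\<dots> = (\<Sum>b\<in>B. c b)"
    using assms by (intro sum.cong) (auto simp: orthonormal_basis_def norm_eq_1)
  finally show ?thesis .
qed

lemma transpose_spectral_matrix: "transpose (spectral_matrix B c) = spectral_matrix B c"
  by (simp add: vec_eq_iff transpose_def spectral_matrix_def outer_self_def mult.commute)

lemma spectral_matrix_product:
  assumes B: "orthonormal_basis B"
  shows "spectral_matrix B c ** spectral_matrix B d = spectral_matrix B (\<lambda>b. c b * d b)"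
proof (rule matrix_eq[THEN iffD2], rule allI)
  fix x
  show "(spectral_matrix B c ** spectral_matrix B d) *v x = spectral_matrix B (\<lambda>b. c b * d b) *v x"
    unfolding matrix_vector_mul_assoc[symmetric] spectral_matrix_mult
    using B by (intro sum.cong) (auto simp: orthonormal_basis_def inner_orthonormal_sum)
qed

lemma inner_spectral_matrix: "x \<bullet> (spectral_matrix B c *v x) = (\<Sum>b\<in>B. c b * (b \<bullet> x)\<^sup>2)"
  by (simp add: spectral_matrix_mult inner_sum_right power2_eq_square inner_commute mult.assoc)

lemma psd_spectral_matrix:
  assumes "\<And>b. b \<in> B \<Longrightarrow> 0 \<le> c b"
  shows "psd (spectral_matrix B c)"
  using assms by (auto simp: psd_def transpose_spectral_matrix inner_spectral_matrix intro!: sum_nonneg)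

lemma symmetric_spectral_decomposition:
  fixes A :: "real ^ 'n ^ 'n"
  assumes sym: "transpose A = A"
  obtains B l where "orthonormal_basis B" "A = spectral_matrix B l"
    "\<And>b. b \<in> B \<Longrightarrow> A *v b = l b *\<^sub>R b"
proof -
  obtain B l where B: "orthonormal_basis B" and l: "\<And>b. b \<in> B \<Longrightarrow> A *v b = l b *\<^sub>R b"
    using spectral_theorem[OF sym] by blast
  have "A *v x = spectral_matrix B l *v x" for x
  proof -
    have "A *v x = A *v (\<Sum>b\<in>B. (b \<bullet> x) *\<^sub>R b)" using B by (simp add: orthonormal_basis_def)
    also have "\<dots> = (\<Sum>b\<in>B. (b \<bullet> x) *\<^sub>R (A *v b))"
      by (simp add: linear_sum matrix_vector_mult_scaleR)
    also have "\<dots> = spectral_matrix B l *v x"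
      unfolding spectral_matrix_mult by (intro sum.cong) (auto simp: l)
    finally show ?thesis .
  qed
  hence "A = spectral_matrix B l" by (simp add: matrix_eq)
  thus ?thesis using that B l by blast
qed

lemma psd_spectral_decomposition:
  fixes A :: "real ^ 'n ^ 'n"
  assumes "psd A"
  obtains B l where "orthonormal_basis B" "A = spectral_matrix B l" "\<And>b. b \<in> B \<Longrightarrow> 0 \<le> l b"
proof -
  obtain B l where B: "orthonormal_basis B" and A: "A = spectral_matrix B l"
    and l: "\<And>b. b \<in> B \<Longrightarrow> A *v b = l b *\<^sub>R b"
    using symmetric_spectral_decomposition assms unfolding psd_def by blast
  have "0 \<le> l b" if "b \<in> B" for b
  proof -
    have "b \<bullet> b = 1" using B that by (simp add: orthonormal_basis_def norm_eq_1)
    moreover have "0 \<le> b \<bullet> (A *v b)" using assms by (simp add: psd_def)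
    ultimately show ?thesis using l[OF that] by simp
  qed
  thus ?thesis using that B A by blast
qed

section \<open>Operator norm of a symmetric matrix\<close>

lemma op_norm_bound: "norm (A *v x) \<le> op_norm A * norm x"
  unfolding op_norm_def by (rule onorm) simp

lemma op_norm_nonneg: "0 \<le> op_norm A"
  unfolding op_norm_def by (rule onorm_pos_le) simp

lemma quadratic_form_le_op_norm: "x \<bullet> (A *v x) \<le> op_norm A * (x \<bullet> x)"
proof -
  have "x \<bullet> (A *v x) \<le> norm x * norm (A *v x)" by (rule norm_cauchy_schwarz)
  also have "\<dots> \<le> norm x * (op_norm A * norm x)" by (intro mult_left_mono op_norm_bound) simp
  finally show ?thesis by (simp add: dot_square_norm power2_eq_square mult_ac)
qed

text \<open>For a symmetric matrix the eigenvalues are values of the quadratic form at unit vectors, and they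
  determine the operator norm.\<close>

lemma op_norm_le_quadratic_form:
  fixes A :: "real ^ 'n ^ 'n"
  assumes sym: "transpose A = A" and c: "\<And>v. norm v \<le> 1 \<Longrightarrow> \<bar>v \<bullet> (A *v v)\<bar> \<le> c"
  shows "op_norm A \<le> c"
proof -
  obtain B l where B: "orthonormal_basis B" and A: "A = spectral_matrix B l"
    and l: "\<And>b. b \<in> B \<Longrightarrow> A *v b = l b *\<^sub>R b"
    using symmetric_spectral_decomposition[OF sym] by blast
  have c0: "0 \<le> c" using c[of 0] by simp
  have lc: "\<bar>l b\<bar> \<le> c" if "b \<in> B" for b
  proof -
    have "norm b = 1" using B that by (simp add: orthonormal_basis_def)
    hence "b \<bullet> (A *v b) = l b" using l[OF that] by (simp add: norm_eq_1)
    thus ?thesis using c[of b] \<open>norm b = 1\<close> by simp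
  qed
  have "norm (A *v x) \<le> c * norm x" for x
  proof -
    have "(norm (A *v x))\<^sup>2 = x \<bullet> (A *v (A *v x))"
      by (simp add: power2_norm_eq_inner symmetric_inner_swap[OF sym, of x])
    also have "\<dots> = x \<bullet> (spectral_matrix B (\<lambda>b. l b * l b) *v x)"
      unfolding A by (simp add: matrix_vector_mul_assoc spectral_matrix_product[OF B])
    also have "\<dots> \<le> (\<Sum>b\<in>B. (c * c) * (b \<bullet> x)\<^sup>2)"
      unfolding inner_spectral_matrix using lc c0
      by (intro sum_mono mult_right_mono) (auto simp flip: power2_eq_square intro!: abs_le_square_iff[THEN iffD1])
    also have "\<dots> = c\<^sup>2 * (x \<bullet> x)"
    proof -
      have "x \<bullet> (\<Sum>b\<in>B. (b \<bullet> x) *\<^sub>R b) = (\<Sum>b\<in>B. (b \<bullet> x)\<^sup>2)"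
        by (simp add: inner_sum_right power2_eq_square inner_commute)
      moreover have "(\<Sum>b\<in>B. (b \<bullet> x) *\<^sub>R b) = x" using B by (simp add: orthonormal_basis_def)
      ultimately show ?thesis by (simp add: sum_distrib_left[symmetric] power2_eq_square)
    qed
    also have "\<dots> = (c * norm x)\<^sup>2" by (simp add: power_mult_distrib power2_norm_eq_inner)
    finally have "(norm (A *v x))\<^sup>2 \<le> (c * norm x)\<^sup>2" .
    thus ?thesis by (rule power2_le_imp_le) (use c0 in simp)
  qed
  thus ?thesis unfolding op_norm_def by (rule onorm_le)
qed

lemma op_norm_le_trace:
  fixes A :: "real ^ 'n ^ 'n"
  assumes A: "psd A"
  shows "op_norm A \<le> trace A"
proof -
  obtain B l where B: "orthonormal_basis B" and AB: "A = spectral_matrix B l"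
    and l: "\<And>b. b \<in> B \<Longrightarrow> 0 \<le> l b"
    using psd_spectral_decomposition[OF A] by blast
  have "\<bar>v \<bullet> (A *v v)\<bar> \<le> trace A" if v: "norm v \<le> 1" for v
  proof -
    have "v \<bullet> (A *v v) \<le> (\<Sum>b\<in>B. l b * 1)"
      unfolding AB inner_spectral_matrix
    proof (intro sum_mono mult_left_mono l)
      fix b assume b: "b \<in> B"
      have "\<bar>b \<bullet> v\<bar> \<le> norm b * norm v" by (rule Cauchy_Schwarz_ineq2)
      also have "\<dots> \<le> 1" using B b v by (simp add: orthonormal_basis_def)
      finally show "(b \<bullet> v)\<^sup>2 \<le> 1" by (simp add: abs_square_le_1)
    qed
    thus ?thesis using A trace_spectral_matrix[OF B, of l] by (simp add: psd_def AB[symmetric])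
  qed
  thus ?thesis using A by (intro op_norm_le_quadratic_form) (auto simp: psd_def)
qed

text \<open>Sublevel sets of the operator norm are closed, being intersections of the closed
  conditions \<open>norm (A *v x) \<le> c * norm x\<close>.\<close>

lemma op_norm_le_measurable:
  fixes G :: "'a \<Rightarrow> real ^ 'n ^ 'n"
  assumes [measurable]: "G \<in> borel_measurable M"
  shows "{\<omega> \<in> space M. op_norm (G \<omega>) \<le> c} \<in> sets M"
proof -
  have eq: "{A :: real ^ 'n ^ 'n. op_norm A \<le> c} = (\<Inter>x. {A. norm (A *v x) \<le> c * norm x})"
  proof (intro equalityI subsetI)
    fix A :: "real ^ 'n ^ 'n" assume "A \<in> {A. op_norm A \<le> c}"
    hence "norm (A *v x) \<le> c * norm x" for x
      by (intro order_trans[OF op_norm_bound] mult_right_mono) auto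
    thus "A \<in> (\<Inter>x. {A. norm (A *v x) \<le> c * norm x})" by simp
  next
    fix A :: "real ^ 'n ^ 'n" assume "A \<in> (\<Inter>x. {A. norm (A *v x) \<le> c * norm x})"
    thus "A \<in> {A. op_norm A \<le> c}" by (auto simp: op_norm_def intro!: onorm_le)
  qed
  have "closed {A :: real ^ 'n ^ 'n. norm (A *v x) \<le> c * norm x}" for x
  proof -
    have "linear (\<lambda>A :: real ^ 'n ^ 'n. A *v x)"
      by (intro linearI) (simp_all add: matrix_vector_mult_add_rdistrib scaleR_matrix_vector_assoc[symmetric])
    hence "continuous_on UNIV (\<lambda>A :: real ^ 'n ^ 'n. A *v x)" by (rule linear_continuous_on_compose[OF continuous_on_id])
    thus ?thesis by (intro closed_Collect_le continuous_intros)
  qed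
  hence "closed {A :: real ^ 'n ^ 'n. op_norm A \<le> c}" unfolding eq by (intro closed_INT) simp
  hence "{A :: real ^ 'n ^ 'n. op_norm A \<le> c} \<in> sets borel" by (rule borel_closed)
  from measurable_sets[OF assms this] show ?thesis by (simp add: vimage_def Int_def conj_commute)
qed

section \<open>Square root and Moore--Penrose inverse\<close>

text \<open>If \<open>R\<^sup>2 = S\<^sup>2\<close> then \<open>D = R - S\<close> satisfies \<open>R D + D S = 0\<close>.  Evaluated at a unit eigenvector \<open>b\<close> of
  \<open>D\<close> with eigenvalue \<open>l\<close> this reads \<open>l (b \<bullet> R b + b \<bullet> S b) = 0\<close>; if \<open>l\<close> were nonzero, both
  nonnegative terms would vanish, and so would their difference, which is \<open>l\<close>.\<close>

lemma psd_sqrt_unique: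
  fixes R S :: "real ^ 'n ^ 'n"
  assumes R: "psd R" and S: "psd S" and eq: "R ** R = S ** S"
  shows "R = S"
proof -
  define D where "D = R - S"
  have sD: "transpose D = D"
    using R S by (simp add: D_def psd_def transpose_def vec_eq_iff)
  obtain B l where B: "orthonormal_basis B" and D: "D = spectral_matrix B l"
    and l: "\<And>b. b \<in> B \<Longrightarrow> D *v b = l b *\<^sub>R b"
    using symmetric_spectral_decomposition[OF sD] by blast
  have "l b = 0" if b: "b \<in> B" for b
  proof (rule ccontr)
    assume nz: "l b \<noteq> 0"
    have bb: "b \<bullet> b = 1" using B b by (simp add: orthonormal_basis_def norm_eq_1)
    have Db: "R *v b - S *v b = l b *\<^sub>R b"
      using l[OF b] by (simp add: D_def matrix_vector_mult_diff_rdistrib)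
    have RR: "R *v (R *v b) = S *v (S *v b)"
      using eq by (simp add: matrix_vector_mul_assoc)
    have "b \<bullet> (R *v (R *v b - S *v b)) + (R *v b - S *v b) \<bullet> (S *v b) = 0"
    proof -
      have "b \<bullet> (R *v (R *v b - S *v b)) = b \<bullet> (S *v (S *v b)) - (R *v b) \<bullet> (S *v b)"
        using R RR symmetric_inner_swap[of R b "S *v b"]
        by (simp add: matrix_vector_mult_diff_distrib inner_diff_right psd_def)
      also have "b \<bullet> (S *v (S *v b)) = (S *v b) \<bullet> (S *v b)"
        using S symmetric_inner_swap[of S b "S *v b"] by (simp add: psd_def)
      finally show ?thesis by (simp add: inner_diff_left)
    qed
    hence "l b * (b \<bullet> (R *v b) + b \<bullet> (S *v b)) = 0"
      by (simp add: Db matrix_vector_mult_scaleR algebra_simps)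
    hence "b \<bullet> (R *v b) + b \<bullet> (S *v b) = 0" using nz by simp
    moreover have "0 \<le> b \<bullet> (R *v b)" "0 \<le> b \<bullet> (S *v b)" using R S by (auto simp: psd_def)
    ultimately have "b \<bullet> (R *v b) = 0" "b \<bullet> (S *v b) = 0" by linarith+
    hence "b \<bullet> (l b *\<^sub>R b) = 0" unfolding Db[symmetric] by (simp add: inner_diff_right)
    thus False using nz bb by simp
  qed
  hence "D = 0" by (simp add: D spectral_matrix_def)
  thus ?thesis by (simp add: D_def)
qed

lemma psd_sqrt_properties:
  fixes A :: "real ^ 'n ^ 'n"
  assumes "psd A"
  shows "psd (psd_sqrt A)" "psd_sqrt A ** psd_sqrt A = A"
proof -
  obtain B l where B: "orthonormal_basis B" and A: "A = spectral_matrix B l"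
    and l: "\<And>b. b \<in> B \<Longrightarrow> 0 \<le> l b"
    using psd_spectral_decomposition[OF assms] by blast
  define R where "R = spectral_matrix B (\<lambda>b. sqrt (l b))"
  have "R ** R = A"
    unfolding R_def spectral_matrix_product[OF B] using l by (simp add: A spectral_matrix_def)
  moreover have "psd R" unfolding R_def using l by (intro psd_spectral_matrix) auto
  ultimately have R: "psd R \<and> R ** R = A" by simp
  hence "psd_sqrt A = R"
    unfolding psd_sqrt_def by (intro the_equality) (auto intro: psd_sqrt_unique)
  thus "psd (psd_sqrt A)" "psd_sqrt A ** psd_sqrt A = A" using R by auto
qed

lemma is_mp_inverse_unique:
  assumes "is_mp_inverse A B" "is_mp_inverse A C"
  shows "B = C"
proof -
  have B: "A ** B ** A = A" "B ** A ** B = B" "transpose (A ** B) = A ** B" "transpose (B ** A) = B ** A"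
    and C: "A ** C ** A = A" "C ** A ** C = C" "transpose (A ** C) = A ** C" "transpose (C ** A) = C ** A"
    using assms by (auto simp: is_mp_inverse_def)
  have "A ** B = (A ** C) ** (A ** B)" using C(1) by (simp add: matrix_mul_assoc)
  also have "\<dots> = transpose ((A ** B) ** (A ** C))" by (simp only: matrix_transpose_mul[of "A ** B" "A ** C"] B(3) C(3))
  also have "\<dots> = A ** C" using B(1) C(3) by (simp add: matrix_mul_assoc)
  finally have AB: "A ** B = A ** C" .
  have "B ** A = (B ** A) ** (C ** A)" using C(1) by (simp add: matrix_mul_assoc[symmetric])
  also have "\<dots> = transpose ((C ** A) ** (B ** A))" by (simp only: matrix_transpose_mul[of "C ** A" "B ** A"] B(4) C(4))
  also have "\<dots> = C ** A" using B(1) C(4) by (simp add: matrix_mul_assoc[symmetric])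
  finally have BA: "B ** A = C ** A" .
  have "B = B ** (A ** B)" using B(2) by (simp add: matrix_mul_assoc)
  also have "\<dots> = (B ** A) ** C" by (simp add: AB matrix_mul_assoc)
  also have "\<dots> = C" using C(2) by (simp add: BA)
  finally show ?thesis .
qed

text \<open>Inverting the nonzero eigenvalues gives the Moore--Penrose inverse; zero eigenvalues
  stay zero because \<open>inverse 0 = 0\<close>.\<close>

lemma mp_inverse_properties:
  fixes A :: "real ^ 'n ^ 'n"
  assumes "psd A"
  shows "psd (mp_inverse A)" "A ** mp_inverse A ** A = A"
proof -
  obtain B l where B: "orthonormal_basis B" and A: "A = spectral_matrix B l"
    and l: "\<And>b. b \<in> B \<Longrightarrow> 0 \<le> l b"
    using psd_spectral_decomposition[OF assms] by blast
  define R where "R = spectral_matrix B (\<lambda>b. inverse (l b))"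
  have *: "l b * inverse (l b) * l b = l b" for b by (cases "l b = 0") auto
  have **: "inverse (l b) * l b * inverse (l b) = inverse (l b)" for b by (cases "l b = 0") auto
  have R: "is_mp_inverse A R"
    unfolding R_def A is_mp_inverse_def spectral_matrix_product[OF B] * ** transpose_spectral_matrix
    by simp
  hence "mp_inverse A = R"
    unfolding mp_inverse_def by (intro the_equality) (auto intro: is_mp_inverse_unique)
  moreover have "psd R" unfolding R_def using l by (intro psd_spectral_matrix) auto
  ultimately show "psd (mp_inverse A)" "A ** mp_inverse A ** A = A"
    using R by (auto simp: is_mp_inverse_def)
qed

text \<open>A linear functional of a vector with second moment matrix \<open>A\<close> is turned into one of the whitened
  vector.  With \<open>B = psd_sqrt (mp_inverse A)\<close> and \<open>u = B A v\<close>, the functional \<open>x \<bullet> v\<close> and the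
  functional \<open>(B x) \<bullet> u = x \<bullet> (B u)\<close> differ by \<open>x \<bullet> (v - B u)\<close>, which is almost surely zero as
  \<open>v - B u\<close> lies in the kernel of \<open>A\<close>.  The squared length of \<open>u\<close> is the second
  moment of \<open>x \<bullet> v\<close>.\<close>

lemma whitening_vector:
  fixes A :: "real ^ 'n ^ 'n" and v :: "real ^ 'n"
  assumes "psd A"
  defines "B \<equiv> psd_sqrt (mp_inverse A)"
  defines "u \<equiv> B *v (A *v v)"
  shows "u \<bullet> u = v \<bullet> (A *v v)" "A *v (v - B *v u) = 0" "transpose B = B"
proof -
  note mp = mp_inverse_properties[OF assms(1)]
  note sq = psd_sqrt_properties[OF mp(1), folded B_def]
  show B: "transpose B = B" using sq(1) unfolding psd_def by blast
  have A: "transpose A = A" using assms(1) unfolding psd_def by blast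
  have Bu: "B *v u = mp_inverse A *v (A *v v)"
    unfolding u_def by (simp only: matrix_vector_mul_assoc[of B B] sq(2))
  have AA: "A *v (B *v u) = A *v v"
    unfolding Bu by (simp only: matrix_vector_mul_assoc matrix_mul_assoc mp(2))
  show "A *v (v - B *v u) = 0" unfolding matrix_vector_mult_diff_distrib AA by simp
  have "u \<bullet> u = (A *v v) \<bullet> (B *v u)"
    using symmetric_inner_swap[OF B, of "A *v v" u] by (simp only: u_def)
  also have "\<dots> = v \<bullet> (A *v (B *v u))"
    by (rule symmetric_inner_swap[OF A, symmetric])
  finally show "u \<bullet> u = v \<bullet> (A *v v)" unfolding AA .
qed

section \<open>The Herbst argument for self-bounding functions\<close>

lemma exp_quadratic_bound:
  fixes z :: real
  assumes "\<bar>z\<bar> \<le> 1"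
  shows "\<bar>exp z - 1 - z\<bar> \<le> z\<^sup>2"
proof -
  have "exp z \<le> 1 + z + z\<^sup>2"
  proof (cases "z \<ge> 0")
    case True
    thus ?thesis using assms exp_bound[of z] by simp
  next
    case False
    define w where "w = - z"
    have w: "0 < w" "w \<le> 1" using False assms by (auto simp: w_def)
    have "exp z = 1 / exp w" by (simp add: w_def exp_minus field_simps)
    also have "\<dots> \<le> 1 / (1 + w)"
      using w exp_ge_add_one_self[of w] by (intro divide_left_mono) auto
    also have "\<dots> \<le> 1 - w + w\<^sup>2"
    proof -
      have "(1 - w + w\<^sup>2) * (1 + w) = 1 + w ^ 3"
        by (simp add: algebra_simps power2_eq_square power3_eq_cube)
      thus ?thesis using w by (simp add: divide_le_eq)
    qed
    finally show ?thesis by (simp add: w_def)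
  qed
  thus ?thesis
    using exp_ge_add_one_self[of z] zero_le_power2[of z] unfolding abs_le_iff by linarith
qed

lemma mult_le_abs_mult:
  fixes k x :: real
  assumes "\<bar>x\<bar> \<le> N"
  shows "k * x \<le> \<bar>k\<bar> * N"
proof -
  have "k * x \<le> \<bar>k\<bar> * \<bar>x\<bar>" by (metis abs_ge_self abs_mult)
  also have "\<dots> \<le> \<bar>k\<bar> * N" using assms by (intro mult_left_mono) auto
  finally show ?thesis .
qed

lemma gradient_eq:
  assumes "GDERIV f x :> D"
  shows "gradient f x = D"
  unfolding gradient_def
proof (rule the_equality)
  show "GDERIV f x :> D" by fact
  fix E assume "GDERIV f x :> E"
  hence "(\<lambda>h. h \<bullet> E) = (\<lambda>h. h \<bullet> D)"
    using assms has_derivative_unique unfolding gderiv_def by blast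
  hence "(E - D) \<bullet> E = (E - D) \<bullet> D" by metis
  hence "(E - D) \<bullet> (E - D) = 0" by (simp add: inner_diff_right)
  thus "E = D" by simp
qed

lemma measurable_of_gradient:
  fixes g :: "'a::euclidean_space \<Rightarrow> real"
  assumes "\<And>x. GDERIV g x :> G x"
  shows "g \<in> borel_measurable borel"
  using assms unfolding gderiv_def
  by (intro borel_measurable_continuous_onI continuous_at_imp_continuous_on ballI has_derivative_continuous) blast

lemma locally_lipschitz_bounded_gradient:
  fixes f :: "'a::euclidean_space \<Rightarrow> real"
  assumes "\<And>x. GDERIV f x :> D x" "\<And>x. norm (D x) \<le> L"
  shows "locally_lipschitz f"
proof -
  have L: "0 \<le> L" using assms(2)[of 0] norm_ge_zero order_trans by blast
  have "L-lipschitz_on (cball x 1) f" for x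
  proof (rule bounded_derivative_imp_lipschitz)
    show "(f has_derivative (\<lambda>h. h \<bullet> D y)) (at y within cball x 1)" for y
      using assms(1)[of y] unfolding gderiv_def by (rule has_derivative_at_withinI)
    show "onorm (\<lambda>h. h \<bullet> D y) \<le> L" for y
    proof (rule onorm_le)
      fix h :: 'a
      have "norm (h \<bullet> D y) \<le> norm h * norm (D y)" by (simp add: Cauchy_Schwarz_ineq2)
      also have "\<dots> \<le> L * norm h" using mult_left_mono[OF assms(2)[of y] norm_ge_zero[of h]] by (simp add: mult.commute)
      finally show "norm (h \<bullet> D y) \<le> L * norm h" .
    qed
  qed (use L in auto)
  thus ?thesis unfolding locally_lipschitz_def by (intro allI exI[of _ 1] conjI exI[of _ L]) auto
qed

context prob_space
begin

lemma mgf_has_field_derivative: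
  fixes g :: "'a \<Rightarrow> real"
  assumes [measurable]: "g \<in> borel_measurable M" and g: "\<And>x. \<bar>g x\<bar> \<le> N"
  shows "((\<lambda>l. \<integral>x. exp (l * g x) \<partial>M) has_field_derivative (\<integral>x. g x * exp (l * g x) \<partial>M)) (at l)"
proof -
  have N: "0 \<le> N" using g[of undefined] by linarith
  have kb: "k * g x \<le> \<bar>k\<bar> * N" for k x
    using g[of x] by (intro mult_le_abs_mult) auto
  have eb: "exp (k * g x) \<le> exp (\<bar>k\<bar> * N)" for k x by (simp add: kb)
  have i1: "integrable M (\<lambda>x. exp (k * g x))" for k
    by (rule integrable_const_bound[where B="exp (\<bar>k\<bar> * N)"]) (auto simp: kb)
  have i2: "integrable M (\<lambda>x. g x * exp (k * g x))" for k
  proof (rule integrable_const_bound[where B="N * exp (\<bar>k\<bar> * N)"], rule AE_I2)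
    show "norm (g x * exp (k * g x)) \<le> N * exp (\<bar>k\<bar> * N)" for x
      unfolding real_norm_def abs_mult abs_exp_cancel by (intro mult_mono g eb N) auto
  qed measurable
  define c where "c = exp (\<bar>l\<bar> * N) * N\<^sup>2"
  define F where "F k = (\<integral>x. exp (k * g x) \<partial>M)" for k
  define d where "d = (\<integral>x. g x * exp (l * g x) \<partial>M)"
  have bnd: "\<bar>F (l + h) - F l - h * d\<bar> \<le> c * h\<^sup>2" if h: "\<bar>h\<bar> * N \<le> 1" for h
  proof -
    have eq: "F (l + h) - F l - h * d = (\<integral>x. exp ((l + h) * g x) - exp (l * g x) - h * (g x * exp (l * g x)) \<partial>M)"
      unfolding F_def d_def using i1 i2 by simp
    have "norm (F (l + h) - F l - h * d) \<le> (\<integral>x. norm (exp ((l + h) * g x) - exp (l * g x) - h * (g x * exp (l * g x))) \<partial>M)"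
      unfolding eq by (rule integral_norm_bound)
    also have "\<dots> \<le> (\<integral>x. c * h\<^sup>2 \<partial>M)"
    proof (rule integral_mono)
      show "integrable M (\<lambda>x. norm (exp ((l + h) * g x) - exp (l * g x) - h * (g x * exp (l * g x))))"
        using i1 i2 by auto
      fix x
      have a: "\<bar>h * g x\<bar> \<le> 1"
      proof -
        have "\<bar>h * g x\<bar> \<le> \<bar>h\<bar> * N" unfolding abs_mult using g by (intro mult_left_mono) auto
        thus ?thesis using h by simp
      qed
      have "exp ((l + h) * g x) - exp (l * g x) - h * (g x * exp (l * g x))
          = exp (l * g x) * (exp (h * g x) - 1 - h * g x)"
        by (simp add: algebra_simps exp_add)
      hence "norm (exp ((l + h) * g x) - exp (l * g x) - h * (g x * exp (l * g x)))
          = exp (l * g x) * \<bar>exp (h * g x) - 1 - h * g x\<bar>" by (simp add: abs_mult)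
      also have "\<dots> \<le> exp (\<bar>l\<bar> * N) * (h * g x)\<^sup>2"
        by (intro mult_mono eb exp_quadratic_bound a) auto
      also have "\<dots> \<le> exp (\<bar>l\<bar> * N) * (h\<^sup>2 * N\<^sup>2)"
        using power_mono[OF g[of x] abs_ge_zero, of 2]
        by (intro mult_left_mono) (auto simp: power_mult_distrib intro!: mult_left_mono)
      finally show "norm (exp ((l + h) * g x) - exp (l * g x) - h * (g x * exp (l * g x))) \<le> c * h\<^sup>2"
        by (simp add: c_def mult_ac)
    qed simp
    also have "\<dots> = c * h\<^sup>2" by (simp add: prob_space)
    finally show ?thesis by simp
  qed
  have "((\<lambda>h. (F (l + h) - F l) / h - d) \<longlongrightarrow> 0) (at 0)"
  proof (rule Lim_null_comparison)
    show "((\<lambda>h. c * \<bar>h\<bar>) \<longlongrightarrow> 0) (at (0::real))"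
      by (auto intro!: tendsto_eq_intros)
    have "1 / (N + 1) > 0" using N by simp
    moreover have "norm ((F (l + h) - F l) / h - d) \<le> c * \<bar>h\<bar>" if h: "h \<noteq> 0" "dist h 0 < 1 / (N + 1)" for h
    proof -
      have "\<bar>h\<bar> < 1 / (N + 1)" using h(2) by simp
      hence "\<bar>h\<bar> * (N + 1) < 1" using N by (simp add: pos_less_divide_eq)
      hence "\<bar>h\<bar> * N \<le> 1" by (simp add: algebra_simps)
      hence "\<bar>F (l + h) - F l - h * d\<bar> \<le> c * h\<^sup>2" by (rule bnd)
      hence "\<bar>F (l + h) - F l - h * d\<bar> / \<bar>h\<bar> \<le> c * h\<^sup>2 / \<bar>h\<bar>" by (intro divide_right_mono) auto
      moreover have "(F (l + h) - F l) / h - d = (F (l + h) - F l - h * d) / h"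
        using h(1) by (simp add: field_simps)
      moreover have "c * h\<^sup>2 / \<bar>h\<bar> = c * \<bar>h\<bar>"
        using h(1) by (metis abs_mult_self_eq nonzero_mult_div_cancel_right abs_eq_0 mult.assoc power2_eq_square)
      ultimately show ?thesis by (simp add: abs_divide)
    qed
    ultimately show "\<forall>\<^sub>F h in at 0. norm ((F (l + h) - F l) / h - d) \<le> c * \<bar>h\<bar>"
      unfolding eventually_at by blast
  qed
  hence "((\<lambda>h. (F (l + h) - F l) / h) \<longlongrightarrow> d) (at 0)" by (simp add: LIM_zero_iff)
  thus ?thesis unfolding DERIV_def F_def d_def .
qed

end

text \<open>The log-Sobolev inequality for \<open>exp (l g / 2)\<close>.  The self-bounding hypothesis
  \<open>|grad g|\<^sup>2 \<le> 4 a g\<close> bounds the energy by a multiple of the derivative \<open>F'\<close> of the Laplace transform,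
  so that the inequality is a differential inequality for \<open>F\<close> alone.  Boundedness of \<open>g\<close> makes the
  test function bounded and globally Lipschitz.\<close>

lemma herbst_entropy_bound:
  fixes P :: "'a::euclidean_space measure" and g :: "'a \<Rightarrow> real"
  assumes "prob_space P" and sets: "sets P = sets borel" and ls: "log_sobolev P C" and C: "0 \<le> C"
    and a: "0 \<le> a" and g: "\<And>y. 0 \<le> g y" "\<And>y. g y \<le> N" and G: "\<And>y. GDERIV g y :> G y"
    and Gm: "G \<in> borel_measurable borel" and sb: "\<And>y. (norm (G y))\<^sup>2 \<le> 4 * a * g y"
  defines "F \<equiv> \<lambda>l. \<integral>y. exp (l * g y) \<partial>P" and "F' \<equiv> \<lambda>l. \<integral>y. g y * exp (l * g y) \<partial>P"
  shows "l * F' l - F l * ln (F l) \<le> 2 * C * a * l\<^sup>2 * F' l"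
proof -
  interpret prob_space P by fact
  have [measurable_cong]: "sets P = sets borel" by fact
  have N: "0 \<le> N" using g[of 0] by linarith
  have gm[measurable]: "g \<in> borel_measurable borel" by (rule measurable_of_gradient[OF G])
  note Gm[measurable]
  have kb: "k * g x \<le> \<bar>k\<bar> * N" for k x
    using g[of x] by (intro mult_le_abs_mult) auto
  have eb: "exp (k * g x) \<le> exp (\<bar>k\<bar> * N)" for k x by (simp add: kb)
  have i1: "integrable P (\<lambda>x. exp (k * g x))" for k
    by (rule integrable_const_bound[where B="exp (\<bar>k\<bar> * N)"]) (auto simp: kb)
  have i2: "integrable P (\<lambda>x. g x * exp (k * g x))" for k
  proof (rule integrable_const_bound[where B="N * exp (\<bar>k\<bar> * N)"], rule AE_I2)
    show "norm (g x * exp (k * g x)) \<le> N * exp (\<bar>k\<bar> * N)" for x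
      unfolding real_norm_def abs_mult abs_exp_cancel
      using g[of x] by (intro mult_mono eb N) auto
  qed measurable
  define f where "f y = exp (l / 2 * g y)" for y
  define D where "D y = (l / 2 * exp (l / 2 * g y)) *\<^sub>R G y" for y
  have fD: "GDERIV f y :> D y" for y
    unfolding f_def D_def by (rule GDERIV_DERIV_compose[OF G]) (auto intro!: derivative_eq_intros)
  have f2: "(f y)\<^sup>2 = exp (l * g y)" for y
    by (simp add: f_def power2_eq_square exp_add[symmetric])
  have Dm[measurable]: "D \<in> borel_measurable borel" unfolding D_def by measurable
  have nD: "(norm (D y))\<^sup>2 \<le> l\<^sup>2 * a * (g y * exp (l * g y))" for y
  proof -
    have "(norm (D y))\<^sup>2 = l\<^sup>2 / 4 * exp (l * g y) * (norm (G y))\<^sup>2"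
      by (simp add: D_def power_mult_distrib power_divide f2[symmetric]) (simp add: f_def)
    also have "\<dots> \<le> l\<^sup>2 / 4 * exp (l * g y) * (4 * a * g y)"
      by (intro mult_left_mono sb) auto
    finally show ?thesis by (simp add: mult_ac)
  qed
  have b: "(norm (D y))\<^sup>2 \<le> l\<^sup>2 * a * (N * exp (\<bar>l\<bar> * N))" for y
    using nD[of y] a N g
    by (rule_tac order_trans[OF nD]) (auto intro!: mult_left_mono mult_mono eb)
  have "norm (D y) \<le> sqrt (l\<^sup>2 * a * (N * exp (\<bar>l\<bar> * N)))" for y
    using b[of y] by (rule real_le_rsqrt)
  hence lip: "locally_lipschitz f" using locally_lipschitz_bounded_gradient[OF fD] by blast
  have gr: "gradient f y = D y" for y by (rule gradient_eq[OF fD])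
  have di: "f differentiable at y" for y using fD[of y] unfolding gderiv_def differentiable_def by blast
  have iD: "integrable P (\<lambda>x. (norm (D x))\<^sup>2)"
    by (rule integrable_const_bound[where B="l\<^sup>2 * a * (N * exp (\<bar>l\<bar> * N))"]) (auto simp: b)
  have "AE x in P. f differentiable (at x)" using di by simp
  moreover have "integrable P (\<lambda>x. (f x)\<^sup>2)" unfolding f2 by (rule i1)
  moreover have "integrable P (\<lambda>x. (norm (gradient f x))\<^sup>2)" unfolding gr by (rule iD)
  ultimately have "Ent P (\<lambda>x. (f x)\<^sup>2) \<le> 2 * C * (\<integral>x. (norm (gradient f x))\<^sup>2 \<partial>P)"
    using ls lip unfolding log_sobolev_def by blast
  also have "\<dots> \<le> 2 * C * (\<integral>x. l\<^sup>2 * a * (g x * exp (l * g x)) \<partial>P)"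
    unfolding gr using C iD i2 by (intro mult_left_mono integral_mono nD) auto
  also have "\<dots> = 2 * C * a * l\<^sup>2 * F' l" unfolding F'_def by simp
  also have "Ent P (\<lambda>x. (f x)\<^sup>2) = l * F' l - F l * ln (F l)"
  proof -
    have "(\<integral>x. exp (l * g x) * ln (exp (l * g x)) \<partial>P) = (\<integral>x. l * (g x * exp (l * g x)) \<partial>P)"
      by (intro Bochner_Integration.integral_cong) auto
    thus ?thesis unfolding Ent_def f2 F_def F'_def by simp
  qed
  finally show ?thesis .
qed

text \<open>With \<open>c = 2 C a\<close>, the entropy bound says that \<open>Q l = ln (F l) (1 / l - c)\<close> has nonpositive
  derivative on each side of \<open>0\<close>, and \<open>Q\<close> tends to the mean of \<open>g\<close> at \<open>0\<close>.  Monotonicity of \<open>Q\<close> on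
  the positive and on the negative half-line therefore gives the same bound for both signs of \<open>l\<close>.\<close>

lemma mgf_self_bounding_bounded:
  fixes P :: "'a::euclidean_space measure" and g :: "'a \<Rightarrow> real"
  assumes P: "prob_space P" and sets: "sets P = sets borel" and ls: "log_sobolev P C" and C: "0 \<le> C"
    and a: "0 \<le> a" and g: "\<And>y. 0 \<le> g y" "\<And>y. g y \<le> N" and G: "\<And>y. GDERIV g y :> G y"
    and Gm: "G \<in> borel_measurable borel" and sb: "\<And>y. (norm (G y))\<^sup>2 \<le> 4 * a * g y"
    and l: "2 * C * a * l < 1"
  shows "(\<integral>y. exp (l * g y) \<partial>P) \<le> exp (l * (\<integral>y. g y \<partial>P) / (1 - 2 * C * a * l))"
proof -
  interpret prob_space P by fact
  have [measurable_cong]: "sets P = sets borel" by fact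
  have gm[measurable]: "g \<in> borel_measurable borel" by (rule measurable_of_gradient[OF G])
  define c where "c = 2 * C * a"
  have c: "0 \<le> c" "c * l < 1" using C a l by (auto simp: c_def)
  define F where "F k = (\<integral>y. exp (k * g y) \<partial>P)" for k
  define F' where "F' k = (\<integral>y. g y * exp (k * g y) \<partial>P)" for k
  define m where "m = (\<integral>y. g y \<partial>P)"
  have ent: "k * F' k - F k * ln (F k) \<le> c * k\<^sup>2 * F' k" for k
    unfolding c_def F_def F'_def by (rule herbst_entropy_bound) fact+
  have dF: "(F has_field_derivative F' k) (at k)" for k
    unfolding F_def F'_def using g by (intro mgf_has_field_derivative[where N=N]) auto
  have Fpos: "F k > 0" for k
  proof -
    have kb: "h * g x \<le> \<bar>h\<bar> * N" for h x using g[of x] by (intro mult_le_abs_mult) auto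
    have ik: "integrable P (\<lambda>x. exp (k * g x))"
      by (rule integrable_const_bound[where B="exp (\<bar>k\<bar> * N)"]) (auto simp: kb)
    have "exp (- (\<bar>k\<bar> * N)) = (\<integral>x. exp (- (\<bar>k\<bar> * N)) \<partial>P)" by (simp add: prob_space)
    also have "\<dots> \<le> F k" unfolding F_def
    proof (rule integral_mono)
      fix x
      show "exp (- (\<bar>k\<bar> * N)) \<le> exp (k * g x)" using kb[of "- k" x] by simp
    qed (use ik in auto)
    finally show ?thesis using exp_gt_zero less_le_trans by blast
  qed
  define Q where "Q k = ln (F k) * (1 / k - c)" for k
  have dQ: "\<exists>y. (Q has_field_derivative y) (at k) \<and> y \<le> 0" if k: "k \<noteq> 0" for k
  proof (intro exI conjI)
    show "(Q has_field_derivative (F' k / F k * (1 / k - c) + ln (F k) * (- 1 / k\<^sup>2))) (at k)"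
      unfolding Q_def using k Fpos[of k]
      by (auto intro!: derivative_eq_intros dF simp: power2_eq_square field_simps)
    have "F' k * (k - c * k\<^sup>2) \<le> F k * ln (F k)" using ent[of k] by (simp add: algebra_simps)
    hence "F' k * (k - c * k\<^sup>2) / (F k * k\<^sup>2) \<le> F k * ln (F k) / (F k * k\<^sup>2)"
      using Fpos[of k] by (intro divide_right_mono) auto
    moreover have "F' k * (k - c * k\<^sup>2) / (F k * k\<^sup>2) = F' k / F k * (1 / k - c)"
      using k Fpos[of k] by (simp add: field_simps power2_eq_square)
    moreover have "F k * ln (F k) / (F k * k\<^sup>2) = ln (F k) / k\<^sup>2" using Fpos[of k] by simp
    ultimately show "F' k / F k * (1 / k - c) + ln (F k) * (- 1 / k\<^sup>2) \<le> 0" by simp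
  qed
  have F0: "F 0 = 1" by (simp add: F_def prob_space)
  have lim: "(Q \<longlongrightarrow> m) (at 0)"
  proof -
    have "((\<lambda>k. ln (F k)) has_field_derivative m) (at 0)"
      using F0 by (auto intro!: derivative_eq_intros dF simp: F'_def m_def)
    hence 1: "((\<lambda>k. ln (F k) / k) \<longlongrightarrow> m) (at 0)" by (simp add: DERIV_def F0)
    have "((\<lambda>k. ln (F k)) \<longlongrightarrow> ln (F 0)) (at 0)"
      by (rule tendsto_ln) (use isContD[OF DERIV_isCont[OF dF[of 0]]] F0 in auto)
    hence "((\<lambda>k. ln (F k) / k - ln (F k) * c) \<longlongrightarrow> m - 0 * c) (at 0)"
      by (intro tendsto_intros 1) (simp add: F0)
    moreover have "(\<lambda>k. ln (F k) / k - ln (F k) * c) = Q" by (auto simp: Q_def field_simps)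
    ultimately show ?thesis by simp
  qed
  have limR: "(Q \<longlongrightarrow> m) (at_right 0)" and limL: "(Q \<longlongrightarrow> m) (at_left 0)"
    using lim unfolding filterlim_at_split by auto
  have "ln (F l) * (1 - c * l) \<le> l * m"
  proof (cases l "0::real" rule: linorder_cases)
    case equal
    have "ln (F 0) * (1 - c * 0) \<le> 0 * m" unfolding F0 by simp
    thus ?thesis unfolding equal .
  next
    case greater
    have "Q l \<le> m"
    proof (rule tendsto_lowerbound[OF limR])
      have "Q l \<le> Q e" if "0 < e" "e < l" for e
        by (rule DERIV_nonpos_imp_nonincreasing) (use that in \<open>auto intro: dQ\<close>)
      thus "\<forall>\<^sub>F e in at_right 0. Q l \<le> Q e"
        unfolding eventually_at_right_field using greater by blast
    qed simp
    hence "l * Q l \<le> l * m" using greater by simp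
    moreover have "l * Q l = ln (F l) * (1 - c * l)" using greater by (simp add: Q_def field_simps)
    ultimately show ?thesis by simp
  next
    case less
    have "m \<le> Q l"
    proof (rule tendsto_upperbound[OF limL])
      have "Q e \<le> Q l" if "l < e" "e < 0" for e
        by (rule DERIV_nonpos_imp_nonincreasing) (use that in \<open>auto intro: dQ\<close>)
      thus "\<forall>\<^sub>F e in at_left 0. Q e \<le> Q l"
        unfolding eventually_at_left_field using less by blast
    qed simp
    hence "l * Q l \<le> l * m" using less by (simp add: mult_left_mono_neg)
    moreover have "l * Q l = ln (F l) * (1 - c * l)" using less by (simp add: Q_def field_simps)
    ultimately show ?thesis by simp
  qed
  hence "ln (F l) \<le> l * m / (1 - c * l)" using c by (simp add: pos_le_divide_eq)
  hence "F l \<le> exp (l * m / (1 - c * l))" using Fpos[of l] by (metis exp_le_cancel_iff exp_ln)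
  thus ?thesis by (simp add: F_def m_def c_def)
qed

text \<open>The truncation \<open>g / (1 + e g)\<close> of \<open>g\<close> is bounded and smooth, and it is again self-bounding with the same
  constant because \<open>x / (1 + e x)\<close> vanishes at \<open>0\<close>, has slope \<open>1\<close> there and is concave.  As \<open>e\<close> tends to \<open>0\<close> the means converge
  by domination, and Fatou's lemma passes the bound to the limit; in particular \<open>exp (l g)\<close> is integrable,
  which is not known beforehand when \<open>l > 0\<close>.\<close>

theorem mgf_self_bounding:
  fixes P :: "'a::euclidean_space measure" and g :: "'a \<Rightarrow> real"
  assumes P: "prob_space P" and sets: "sets P = sets borel" and ls: "log_sobolev P C" and C: "0 \<le> C"
    and a: "0 \<le> a" and g: "\<And>y. 0 \<le> g y" and G: "\<And>y. GDERIV g y :> G y"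
    and Gm: "G \<in> borel_measurable borel" and sb: "\<And>y. (norm (G y))\<^sup>2 \<le> 4 * a * g y"
    and int: "integrable P g" and l: "2 * C * a * l < 1"
  shows "(\<integral>\<^sup>+y. exp (l * g y) \<partial>P) \<le> exp (l * (\<integral>y. g y \<partial>P) / (1 - 2 * C * a * l))"
proof -
  interpret prob_space P by fact
  have [measurable_cong]: "sets P = sets borel" by fact
  have gm[measurable]: "g \<in> borel_measurable borel" by (rule measurable_of_gradient[OF G])
  note Gm[measurable]
  define h where "h n y = g y / (1 + g y * inverse (real (Suc n)))" for n y
  have den: "1 + g y * inverse (real (Suc n)) \<ge> 1" for n y using g[of y] by simp
  have [measurable]: "h n \<in> borel_measurable borel" for n unfolding h_def by measurable
  have h0: "0 \<le> h n y" for n y using g[of y] den[of y n] by (simp add: h_def)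
  have hg: "h n y \<le> g y" for n y
    unfolding h_def using mult_left_mono[OF den[of y n] g[of y]] den[of y n]
    by (subst pos_divide_le_eq) auto
  have hlim: "(\<lambda>n. h n y) \<longlonglongrightarrow> g y" for y
  proof -
    have "(\<lambda>n. h n y) \<longlonglongrightarrow> g y / (1 + g y * 0)"
      unfolding h_def by (intro tendsto_intros LIMSEQ_inverse_real_of_nat) auto
    thus ?thesis by simp
  qed
  have step: "(\<integral>y. exp (l * h n y) \<partial>P) \<le> exp (l * (\<integral>y. h n y \<partial>P) / (1 - 2 * C * a * l))" for n
  proof (rule mgf_self_bounding_bounded[OF P sets ls C a h0 _ _ _ _ l])
    define e where "e = inverse (real (Suc n))"
    have e: "e > 0" by (simp add: e_def)
    have he: "h n y = g y / (1 + g y * e)" for y by (simp add: h_def e_def)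
    show "h n y \<le> 1 / e" for y
      unfolding he using g[of y] e by (simp add: divide_simps) (smt (verit) mult_nonneg_nonneg)
    have p: "1 + g y * e \<ge> 1" for y using g[of y] e by simp
    show "GDERIV (h n) y :> (1 / (1 + g y * e)\<^sup>2) *\<^sub>R G y" for y
      unfolding he[abs_def]
      by (rule GDERIV_DERIV_compose[OF G])
        (use p[of y] in \<open>auto intro!: derivative_eq_intros simp: power2_eq_square divide_simps\<close>)
    show "(\<lambda>y. (1 / (1 + g y * e)\<^sup>2) *\<^sub>R G y) \<in> borel_measurable borel" by measurable
    show "(norm ((1 / (1 + g y * e)\<^sup>2) *\<^sub>R G y))\<^sup>2 \<le> 4 * a * h n y" for y
    proof -
      define d where "d = 1 + g y * e"
      have d: "d \<ge> 1" using p by (simp add: d_def)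
      have "(norm ((1 / d\<^sup>2) *\<^sub>R G y))\<^sup>2 = (1 / d ^ 4) * (norm (G y))\<^sup>2"
        using d by (simp add: power_mult_distrib power_divide power4_eq_xxxx power2_eq_square)
      also have "\<dots> \<le> (1 / d ^ 4) * (4 * a * g y)" by (intro mult_left_mono sb) auto
      also have "\<dots> \<le> (1 / d) * (4 * a * g y)"
        using d a g[of y] self_le_power[of d 4] by (intro mult_right_mono divide_left_mono) auto
      finally show ?thesis by (simp add: he d_def)
    qed
  qed
  have hint: "integrable P (h n)" for n
    by (rule Bochner_Integration.integrable_bound[OF int]) (use h0 hg g in auto)
  have "(\<lambda>n. \<integral>y. h n y \<partial>P) \<longlonglongrightarrow> (\<integral>y. g y \<partial>P)"
    by (rule integral_dominated_convergence[where w=g]) (use hlim h0 hg int in auto)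
  hence "(\<lambda>n. exp (l * (\<integral>y. h n y \<partial>P) / (1 - 2 * C * a * l)))
      \<longlonglongrightarrow> exp (l * (\<integral>y. g y \<partial>P) / (1 - 2 * C * a * l))"
    using l by (intro tendsto_intros) auto
  hence lim: "(\<lambda>n. ennreal (exp (l * (\<integral>y. h n y \<partial>P) / (1 - 2 * C * a * l))))
      \<longlonglongrightarrow> ennreal (exp (l * (\<integral>y. g y \<partial>P) / (1 - 2 * C * a * l)))"
    by (rule tendsto_ennrealI)
  have "(\<integral>\<^sup>+y. exp (l * g y) \<partial>P) = (\<integral>\<^sup>+y. liminf (\<lambda>n. ennreal (exp (l * h n y))) \<partial>P)"
  proof (rule nn_integral_cong)
    fix y
    have "(\<lambda>n. ennreal (exp (l * h n y))) \<longlonglongrightarrow> ennreal (exp (l * g y))"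
      by (intro tendsto_ennrealI tendsto_intros hlim)
    thus "ennreal (exp (l * g y)) = liminf (\<lambda>n. ennreal (exp (l * h n y)))"
      by (rule lim_imp_Liminf[OF trivial_limit_sequentially, symmetric])
  qed
  also have "\<dots> \<le> liminf (\<lambda>n. \<integral>\<^sup>+y. ennreal (exp (l * h n y)) \<partial>P)"
    by (rule nn_integral_liminf) measurable
  also have "\<dots> \<le> liminf (\<lambda>n. ennreal (exp (l * (\<integral>y. h n y \<partial>P) / (1 - 2 * C * a * l))))"
  proof (rule Liminf_mono, rule always_eventually, rule allI)
    fix n
    have "integrable P (\<lambda>y. exp (l * h n y))"
    proof (rule integrable_const_bound[where B="exp (\<bar>l\<bar> * Suc n)"])
      have "l * h n y \<le> \<bar>l\<bar> * Suc n" for y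
      proof -
        have "g y \<le> real (Suc n) * (1 + g y * inverse (real (Suc n)))"
          by (simp add: field_simps del: of_nat_Suc)
        hence "h n y \<le> Suc n" unfolding h_def using den[of y n] by (subst pos_divide_le_eq) auto
        thus ?thesis using h0[of n y] by (intro mult_le_abs_mult) auto
      qed
      thus "AE y in P. norm (exp (l * h n y)) \<le> exp (\<bar>l\<bar> * Suc n)" by simp
    qed measurable
    hence "(\<integral>\<^sup>+y. ennreal (exp (l * h n y)) \<partial>P) = ennreal (\<integral>y. exp (l * h n y) \<partial>P)"
      by (intro nn_integral_eq_integral) auto
    thus "(\<integral>\<^sup>+y. ennreal (exp (l * h n y)) \<partial>P) \<le> ennreal (exp (l * (\<integral>y. h n y \<partial>P) / (1 - 2 * C * a * l)))"
      using step[of n] by (simp add: ennreal_leI)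
  qed
  also have "\<dots> = ennreal (exp (l * (\<integral>y. g y \<partial>P) / (1 - 2 * C * a * l)))"
    using lim by (rule lim_imp_Liminf[OF trivial_limit_sequentially])
  finally show ?thesis .
qed

section \<open>Second moments and quadratic forms\<close>

lemma second_moment_quadratic:
  fixes X :: "'a \<Rightarrow> real ^ 'p"
  assumes "has_bochner_integral M (\<lambda>\<omega>. outer_self (X \<omega>)) S"
  shows "has_bochner_integral M (\<lambda>\<omega>. (X \<omega> \<bullet> v)\<^sup>2) (v \<bullet> (S *v v))"
proof -
  have "linear (\<lambda>A :: real ^ 'p ^ 'p. v \<bullet> (A *v v))"
    by (intro linearI)
      (simp_all add: matrix_vector_mult_add_rdistrib inner_add_right scaleR_matrix_vector_assoc[symmetric])
  hence bl: "bounded_linear (\<lambda>A :: real ^ 'p ^ 'p. v \<bullet> (A *v v))"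
    by (simp add: linear_conv_bounded_linear)
  have "(X \<omega> \<bullet> v)\<^sup>2 = v \<bullet> (outer_self (X \<omega>) *v v)" for \<omega>
    by (simp add: outer_self_mult power2_eq_square inner_commute)
  thus ?thesis using has_bochner_integral_bounded_linear[OF bl assms] by simp
qed

lemma psd_second_moment:
  fixes X :: "'a \<Rightarrow> real ^ 'p"
  assumes S: "has_bochner_integral M (\<lambda>\<omega>. outer_self (X \<omega>)) S"
  shows "psd S"
proof -
  have "linear (transpose :: real ^ 'p ^ 'p \<Rightarrow> real ^ 'p ^ 'p)"
    by (intro linearI) (simp_all add: transpose_def vec_eq_iff)
  hence bl: "bounded_linear (transpose :: real ^ 'p ^ 'p \<Rightarrow> real ^ 'p ^ 'p)"
    by (simp add: linear_conv_bounded_linear)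
  have "transpose (outer_self (X \<omega>)) = outer_self (X \<omega>)" for \<omega>
    by (simp add: transpose_def outer_self_def vec_eq_iff mult.commute)
  hence "has_bochner_integral M (\<lambda>\<omega>. outer_self (X \<omega>)) (transpose S)"
    using has_bochner_integral_bounded_linear[OF bl S] by simp
  hence "transpose S = S" using S by (rule has_bochner_integral_eq)
  moreover have "0 \<le> v \<bullet> (S *v v)" for v
  proof -
    have "(\<integral>\<omega>. (X \<omega> \<bullet> v)\<^sup>2 \<partial>M) = v \<bullet> (S *v v)"
      using second_moment_quadratic[OF S, of v] by (rule has_bochner_integral_integral_eq)
    thus ?thesis by (metis integral_nonneg_AE AE_I2 zero_le_power2)
  qed
  ultimately show ?thesis by (simp add: psd_def)
qed

lemma inner_zero_of_kernel:
  fixes X :: "'a \<Rightarrow> real ^ 'p"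
  assumes S: "has_bochner_integral M (\<lambda>\<omega>. outer_self (X \<omega>)) S" and v: "S *v v = 0"
  shows "AE \<omega> in M. X \<omega> \<bullet> v = 0"
proof -
  have "has_bochner_integral M (\<lambda>\<omega>. (X \<omega> \<bullet> v)\<^sup>2) 0"
    using second_moment_quadratic[OF S, of v] v by simp
  hence "integrable M (\<lambda>\<omega>. (X \<omega> \<bullet> v)\<^sup>2)" "(\<integral>\<omega>. (X \<omega> \<bullet> v)\<^sup>2 \<partial>M) = 0"
    by (auto simp: has_bochner_integral_iff)
  hence "AE \<omega> in M. (X \<omega> \<bullet> v)\<^sup>2 = 0"
    using integral_nonneg_eq_0_iff_AE[of M "\<lambda>\<omega>. (X \<omega> \<bullet> v)\<^sup>2"] by simp
  thus ?thesis by simp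
qed

text \<open>As a function of \<open>y\<close> this is self-bounding with constant \<open>u \<bullet> u\<close>, with equality in the
  self-bounding inequality.\<close>

definition column_energy :: "'a::real_inner \<Rightarrow> 'a ^ 'n \<Rightarrow> real" where
  "column_energy u y = (\<Sum>i\<in>UNIV. (y $ i \<bullet> u)\<^sup>2)"

lemma column_energy_gradient:
  fixes u :: "'a::euclidean_space" and y :: "'a ^ 'n"
  shows "GDERIV (column_energy u) y :> (\<chi> i. (2 * (y $ i \<bullet> u)) *\<^sub>R u)"
proof -
  have "((\<lambda>y. \<Sum>i\<in>UNIV. (y $ i \<bullet> u)\<^sup>2) has_derivative
      (\<lambda>h. \<Sum>i\<in>UNIV. 2 * ((y $ i \<bullet> u) * (h $ i \<bullet> u)))) (at y)"
    by (auto intro!: derivative_eq_intros bounded_linear.has_derivative[OF bounded_linear_vec_nth]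
        simp: mult_ac)
  moreover have "(\<Sum>i\<in>UNIV. 2 * ((y $ i \<bullet> u) * (h $ i \<bullet> u)))
      = h \<bullet> (\<chi> i. (2 * (y $ i \<bullet> u)) *\<^sub>R u)" for h :: "'a ^ 'n"
    by (simp add: inner_vec_def mult_ac)
  ultimately show ?thesis unfolding gderiv_def column_energy_def[abs_def] by simp
qed

lemma column_energy_gradient_norm:
  fixes u :: "'a::euclidean_space" and y :: "'a ^ 'n"
  shows "(norm (\<chi> i. (2 * (y $ i \<bullet> u)) *\<^sub>R u :: 'a ^ 'n))\<^sup>2 = 4 * (u \<bullet> u) * column_energy u y"
  unfolding power2_norm_eq_inner column_energy_def
  by (simp add: inner_vec_def sum_distrib_left power2_eq_square mult_ac)

section \<open>Gaussian weights\<close>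

text \<open>The density of a centred Gaussian with covariance \<open>1 / (2 r)\<close> times the identity, without its
  normalising constant.\<close>

definition gauss :: "real \<Rightarrow> 'a::euclidean_space \<Rightarrow> real" where
  "gauss r x = exp (- r * (x \<bullet> x))"

lemma gauss_pos: "0 < gauss r x"
  by (simp add: gauss_def)

lemma gauss_nonneg[simp]: "0 \<le> gauss r x"
  by (simp add: gauss_def)

lemma gauss_measurable[measurable]: "gauss r \<in> borel_measurable borel"
  unfolding gauss_def[abs_def] by measurable

lemma gauss_shift: "gauss r (c + x) = gauss r x * exp (- 2 * r * (c \<bullet> x) - r * (c \<bullet> c))"
  by (simp add: gauss_def exp_add[symmetric] inner_add_left inner_add_right inner_commute algebra_simps)

lemma integrable_gauss:
  assumes "r > 0"
  shows "integrable lborel (gauss r :: 'a::euclidean_space \<Rightarrow> real)"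
proof (rule integrableI_bounded)
  define s where "s = 1 / sqrt (2 * r)"
  have s: "s > 0" "2 * s\<^sup>2 = 1 / r" using assms by (auto simp: s_def power_divide)
  have one: "integrable lborel (\<lambda>x::real. exp (- r * x\<^sup>2))"
  proof -
    have "integrable lborel (\<lambda>x. sqrt (2 * pi * s\<^sup>2) * normal_density 0 s x)"
      using s by (intro integrable_mult_right integrable_normal_density) auto
    moreover have "sqrt (2 * pi * s\<^sup>2) * normal_density 0 s x = exp (- r * x\<^sup>2)" for x
    proof -
      have "- (x - 0)\<^sup>2 / (2 * s\<^sup>2) = - r * x\<^sup>2" using s(2) by simp
      moreover have "sqrt (2 * pi * s\<^sup>2) \<noteq> 0" using s(1) by simp
      ultimately show ?thesis unfolding normal_density_def by simp
    qed
    ultimately show ?thesis by simp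
  qed
  have "ennreal (norm (gauss r x)) = (\<Prod>b\<in>Basis. ennreal (exp (- r * (x \<bullet> b)\<^sup>2)))" for x :: 'a
  proof -
    have "gauss r x = exp (\<Sum>b\<in>Basis. - r * (x \<bullet> b)\<^sup>2)"
      unfolding gauss_def by (subst euclidean_inner) (simp add: sum_distrib_left power2_eq_square)
    also have "\<dots> = (\<Prod>b\<in>Basis. exp (- r * (x \<bullet> b)\<^sup>2))" by (rule exp_sum) simp
    finally have "gauss r x = (\<Prod>b\<in>Basis. exp (- r * (x \<bullet> b)\<^sup>2))" .
    thus ?thesis using gauss_pos[of r x] by (simp add: prod_ennreal)
  qed
  hence "(\<integral>\<^sup>+x. ennreal (norm (gauss r x)) \<partial>(lborel :: 'a measure))
      = (\<integral>\<^sup>+x. (\<Prod>b\<in>Basis. ennreal (exp (- r * (x \<bullet> b)\<^sup>2))) \<partial>(lborel :: 'a measure))" by simp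
  also have "\<dots> = (\<Prod>b\<in>(Basis :: 'a set). \<integral>\<^sup>+x. ennreal (exp (- r * x\<^sup>2)) \<partial>lborel)"
    by (rule nn_integral_lborel_prod) auto
  also have "\<dots> < \<infinity>"
  proof -
    have "(\<integral>\<^sup>+x. ennreal (exp (- r * x\<^sup>2)) \<partial>lborel) < \<infinity>"
      using one unfolding integrable_iff_bounded by simp
    thus ?thesis by (simp add: power_less_top_ennreal)
  qed
  finally show "(\<integral>\<^sup>+x. ennreal (norm (gauss r x)) \<partial>(lborel :: 'a measure)) < \<infinity>" .
qed measurable

lemma lborel_integral_translate:
  fixes f :: "'a::euclidean_space \<Rightarrow> real"
  assumes [measurable]: "f \<in> borel_measurable borel"
  shows "(\<integral>x. f (c + x) \<partial>lborel) = (\<integral>x. f x \<partial>lborel)"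
proof -
  have "(\<integral>x. f x \<partial>lborel) = (\<integral>x. f x \<partial>distr lborel borel ((+) c))" by (simp add: lborel_distr_plus)
  also have "\<dots> = (\<integral>x. f (c + x) \<partial>lborel)" by (rule integral_distr) auto
  finally show ?thesis ..
qed

lemma lborel_integrable_translate:
  fixes f :: "'a::euclidean_space \<Rightarrow> real"
  assumes [measurable]: "f \<in> borel_measurable borel" and "integrable lborel f"
  shows "integrable lborel (\<lambda>x. f (c + x))"
proof -
  have "integrable (distr lborel borel ((+) c)) f" using assms by (simp add: lborel_distr_plus)
  thus ?thesis by (subst (asm) integrable_distr_eq) auto
qed

lemma lborel_nn_integral_translate:
  fixes f :: "'a::euclidean_space \<Rightarrow> ennreal"
  assumes [measurable]: "f \<in> borel_measurable borel"
  shows "(\<integral>\<^sup>+x. f (c + x) \<partial>lborel) = (\<integral>\<^sup>+x. f x \<partial>lborel)"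
proof -
  have "(\<integral>\<^sup>+x. f x \<partial>lborel) = (\<integral>\<^sup>+x. f x \<partial>distr lborel borel ((+) c))" by (simp add: lborel_distr_plus)
  also have "\<dots> = (\<integral>\<^sup>+x. f (c + x) \<partial>lborel)" by (rule nn_integral_distr) auto
  finally show ?thesis ..
qed

lemma lborel_integral_odd:
  fixes f :: "'a::euclidean_space \<Rightarrow> real"
  assumes [measurable]: "f \<in> borel_measurable borel" and odd: "\<And>x. f (- x) = - f x"
  shows "(\<integral>x. f x \<partial>lborel) = 0"
proof -
  have "(lborel :: 'a measure) = density (distr lborel borel (\<lambda>x. 0 + (- 1) *\<^sub>R x)) (\<lambda>_. ennreal (\<bar>- 1\<bar> ^ DIM('a)))"
    by (rule lborel_affine) simp
  hence refl: "distr lborel borel uminus = (lborel :: 'a measure)" by (simp add: density_1)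
  have "(\<integral>x. f x \<partial>lborel) = (\<integral>x. f x \<partial>distr lborel borel uminus)" by (simp add: refl)
  also have "\<dots> = (\<integral>x. f (- x) \<partial>lborel)" by (rule integral_distr) auto
  also have "\<dots> = - (\<integral>x. f x \<partial>lborel)" by (simp add: odd)
  finally show ?thesis by simp
qed

text \<open>In \<open>exp z + exp (- z)\<close> the odd terms of the cubic Taylor polynomials cancel, and the remainders of
  fourth order are nonnegative.\<close>

lemma cosh_lower_bound: "2 + z\<^sup>2 \<le> exp z + exp (- z)" for z :: real
proof -
  have cubic: "1 + x + x\<^sup>2 / 2 + x ^ 3 / 6 \<le> exp x" for x :: real
  proof -
    obtain s where "exp x = (\<Sum>k<4. x ^ k / fact k) + exp s / fact 4 * x ^ 4"
      using Maclaurin_exp_le[of x 4] by blast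
    moreover have "0 \<le> exp s / fact 4 * x ^ 4" by simp
    moreover have "(\<Sum>k<4. x ^ k / fact k) = 1 + x + x\<^sup>2 / 2 + x ^ 3 / 6"
      by (simp add: eval_nat_numeral)
    ultimately show ?thesis by linarith
  qed
  show ?thesis using cubic[of z] cubic[of "- z"] by simp
qed

text \<open>The upper bound on the second moment comes from translation invariance alone: the translates of the weight by
  \<open>e b\<close> and \<open>- e b\<close> have the mass of the weight itself, while their sum is
  \<open>exp (- r e\<^sup>2)\<close> times the weight times \<open>2 cosh (2 r e (b \<bullet> x))\<close>, which is at least \<open>2 + (2 r e (b \<bullet> x))\<^sup>2\<close>.
  Dividing by \<open>e\<^sup>2\<close> and letting \<open>e\<close> tend to \<open>0\<close> gives the bound.\<close>

lemma gauss_second_moment: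
  fixes b :: "'a::euclidean_space"
  assumes r: "r > 0" and b: "norm b = 1"
  shows "integrable lborel (\<lambda>x. (b \<bullet> x)\<^sup>2 * gauss r x)"
    and "(\<integral>x. (b \<bullet> x)\<^sup>2 * gauss r x \<partial>lborel) \<le> (\<integral>x. gauss r x \<partial>(lborel :: 'a measure)) / (2 * r)"
proof -
  have bb: "b \<bullet> b = 1" using b by (simp add: norm_eq_1)
  note int = integrable_gauss[OF r, where 'a='a]
  have pw: "exp (- r * e\<^sup>2) * (2 * gauss r x + 4 * r\<^sup>2 * e\<^sup>2 * ((b \<bullet> x)\<^sup>2 * gauss r x))
      \<le> gauss r (e *\<^sub>R b + x) + gauss r ((- e) *\<^sub>R b + x)" for e x
  proof -
    define z where "z = 2 * r * e * (b \<bullet> x)"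
    have "gauss r (e *\<^sub>R b + x) + gauss r ((- e) *\<^sub>R b + x)
        = gauss r x * exp (- r * e\<^sup>2) * (exp z + exp (- z))"
      unfolding gauss_shift
      by (simp add: bb z_def power2_eq_square exp_diff exp_minus field_simps)
    also have "\<dots> \<ge> gauss r x * exp (- r * e\<^sup>2) * (2 + z\<^sup>2)"
      using gauss_pos[of r x] by (intro mult_left_mono cosh_lower_bound) auto
    finally show ?thesis by (simp add: z_def power_mult_distrib algebra_simps)
  qed
  have ish: "integrable lborel (\<lambda>x. gauss r (c + x))" for c :: 'a
    by (rule lborel_integrable_translate[OF _ int]) measurable
  show int2: "integrable lborel (\<lambda>x. (b \<bullet> x)\<^sup>2 * gauss r x)"
  proof (rule Bochner_Integration.integrable_bound)
    show "integrable lborel (\<lambda>x. exp r / (4 * r\<^sup>2) * (gauss r (1 *\<^sub>R b + x) + gauss r ((- 1) *\<^sub>R b + x)))"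
      by (intro integrable_mult_right Bochner_Integration.integrable_add ish)
    show "AE x in lborel. norm ((b \<bullet> x)\<^sup>2 * gauss r x)
        \<le> norm (exp r / (4 * r\<^sup>2) * (gauss r (1 *\<^sub>R b + x) + gauss r ((- 1) *\<^sub>R b + x)))"
    proof (rule AE_I2)
      fix x :: 'a
      have "exp (- r) * (4 * r\<^sup>2 * ((b \<bullet> x)\<^sup>2 * gauss r x)) \<le> gauss r (1 *\<^sub>R b + x) + gauss r ((- 1) *\<^sub>R b + x)"
      proof -
        have "exp (- r) * (4 * r\<^sup>2 * ((b \<bullet> x)\<^sup>2 * gauss r x))
            \<le> exp (- r) * (2 * gauss r x + 4 * r\<^sup>2 * ((b \<bullet> x)\<^sup>2 * gauss r x))"
          using gauss_pos[of r x] by (intro mult_left_mono) auto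
        also have "\<dots> \<le> gauss r (1 *\<^sub>R b + x) + gauss r ((- 1) *\<^sub>R b + x)"
          using pw[of 1 x] by simp
        finally show ?thesis .
      qed
      hence "exp r / (4 * r\<^sup>2) * (exp (- r) * (4 * r\<^sup>2 * ((b \<bullet> x)\<^sup>2 * gauss r x)))
          \<le> exp r / (4 * r\<^sup>2) * (gauss r (1 *\<^sub>R b + x) + gauss r ((- 1) *\<^sub>R b + x))"
        by (intro mult_left_mono) auto
      moreover have "exp r / (4 * r\<^sup>2) * (exp (- r) * (4 * r\<^sup>2 * ((b \<bullet> x)\<^sup>2 * gauss r x)))
          = (b \<bullet> x)\<^sup>2 * gauss r x" using r by (simp add: exp_minus)
      moreover have "0 \<le> (b \<bullet> x)\<^sup>2 * gauss r x" using gauss_pos[of r x] by simp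
      ultimately show "norm ((b \<bullet> x)\<^sup>2 * gauss r x)
        \<le> norm (exp r / (4 * r\<^sup>2) * (gauss r (1 *\<^sub>R b + x) + gauss r ((- 1) *\<^sub>R b + x)))"
        unfolding real_norm_def by linarith
    qed
  qed measurable
  define Z where "Z = (\<integral>x. gauss r x \<partial>(lborel :: 'a measure))"
  define I where "I = (\<integral>x. (b \<bullet> x)\<^sup>2 * gauss r x \<partial>lborel)"
  have Z: "Z \<ge> 0" unfolding Z_def by (intro integral_nonneg_AE AE_I2) simp
  have sh: "(\<integral>x. gauss r (c + x) \<partial>lborel) = Z" for c :: 'a
    unfolding Z_def by (rule lborel_integral_translate) measurable
  have main: "exp (- r * e\<^sup>2) * (2 * Z + 4 * r\<^sup>2 * e\<^sup>2 * I) \<le> 2 * Z" for e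
  proof -
    have "exp (- r * e\<^sup>2) * (2 * Z + 4 * r\<^sup>2 * e\<^sup>2 * I)
        = (\<integral>x. exp (- r * e\<^sup>2) * (2 * gauss r x + 4 * r\<^sup>2 * e\<^sup>2 * ((b \<bullet> x)\<^sup>2 * gauss r x)) \<partial>lborel)"
      unfolding Z_def I_def using int int2 by simp
    also have "\<dots> \<le> (\<integral>x. gauss r (e *\<^sub>R b + x) + gauss r ((- e) *\<^sub>R b + x) \<partial>lborel)"
    proof (rule integral_mono)
      show "integrable lborel (\<lambda>x. gauss r (e *\<^sub>R b + x) + gauss r ((- e) *\<^sub>R b + x))"
        by (intro Bochner_Integration.integrable_add ish)
    qed (use int int2 pw in auto)
    also have "\<dots> = Z + Z" by (subst Bochner_Integration.integral_add[OF ish ish]) (simp only: sh)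
    also have "\<dots> = 2 * Z" by simp
    finally show ?thesis .
  qed
  have "2 * r * I \<le> Z * (1 + d)" if d: "0 < d" "d \<le> 1" for d
  proof -
    define e where "e = sqrt (d / r)"
    have e: "e\<^sup>2 = d / r" using d r by (simp add: e_def)
    have "exp (- d) * (2 * Z + 4 * r * d * I) \<le> 2 * Z"
      using main[of e] r unfolding e by (simp add: power2_eq_square field_simps)
    hence "2 * Z + 4 * r * d * I \<le> 2 * Z * exp d" by (simp add: exp_minus field_simps)
    also have "\<dots> \<le> 2 * Z * (1 + d + d\<^sup>2)"
      using exp_bound[of d] d Z by (intro mult_left_mono) auto
    finally have "(2 * d) * (2 * r * I) \<le> (2 * d) * (Z * (1 + d))" by (simp add: algebra_simps power2_eq_square)
    thus ?thesis by (rule mult_left_le_imp_le) (use d in simp)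
  qed
  hence "2 * r * I \<le> Z"
  proof -
    assume *: "\<And>d. 0 < d \<Longrightarrow> d \<le> 1 \<Longrightarrow> 2 * r * I \<le> Z * (1 + d)"
    show ?thesis
    proof (rule ccontr)
      assume "\<not> ?thesis"
      hence gap: "2 * r * I - Z > 0" by simp
      define d where "d = min 1 ((2 * r * I - Z) / (2 * (Z + 1)))"
      have d: "0 < d" "d \<le> 1" using gap Z by (auto simp: d_def)
      have "Z * d \<le> Z * ((2 * r * I - Z) / (2 * (Z + 1)))" using Z by (intro mult_left_mono) (auto simp: d_def)
      also have "\<dots> = (2 * r * I - Z) / 2 * (Z / (Z + 1))" using Z by simp
      also have "\<dots> \<le> (2 * r * I - Z) / 2 * 1" using Z gap by (intro mult_left_mono) auto
      finally have "Z * d \<le> (2 * r * I - Z) / 2" by simp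
      with *[OF d] gap show False by (simp add: algebra_simps)
    qed
  qed
  thus "(\<integral>x. (b \<bullet> x)\<^sup>2 * gauss r x \<partial>lborel) \<le> (\<integral>x. gauss r x \<partial>(lborel :: 'a measure)) / (2 * r)"
    using r unfolding I_def[symmetric] Z_def[symmetric] by (simp add: field_simps)
qed

lemma quadratic_form_measurable[measurable]:
  fixes A :: "real ^ 'n ^ 'n"
  shows "(\<lambda>x. x \<bullet> (A *v x)) \<in> borel_measurable borel"
  by (rule borel_measurable_continuous_onI)
    (rule continuous_on_inner[OF continuous_on_id matrix_vector_mult_linear_continuous_on])

lemma gauss_quadratic_form:
  fixes A :: "real ^ 'n ^ 'n"
  assumes A: "transpose A = A" and r: "r > 0"
  shows "integrable lborel (\<lambda>x. (x \<bullet> (A *v x)) * gauss r x)"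
    and "psd A \<Longrightarrow> (\<integral>x. (x \<bullet> (A *v x)) * gauss r x \<partial>lborel)
      \<le> trace A * (\<integral>x. gauss r x \<partial>(lborel :: (real ^ 'n) measure)) / (2 * r)"
proof -
  obtain B l where B: "orthonormal_basis B" and AB: "A = spectral_matrix B l"
    and l: "\<And>b. b \<in> B \<Longrightarrow> A *v b = l b *\<^sub>R b"
    using symmetric_spectral_decomposition[OF A] by blast
  have nb: "norm b = 1" if "b \<in> B" for b using B that by (simp add: orthonormal_basis_def)
  have eq: "(x \<bullet> (A *v x)) * gauss r x = (\<Sum>b\<in>B. l b * ((b \<bullet> x)\<^sup>2 * gauss r x))" for x
    unfolding AB inner_spectral_matrix by (simp add: sum_distrib_right mult.assoc)
  show "integrable lborel (\<lambda>x. (x \<bullet> (A *v x)) * gauss r x)"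
    unfolding eq using gauss_second_moment(1)[OF r nb]
    by (intro Bochner_Integration.integrable_sum integrable_mult_right) auto
  assume psd: "psd A"
  define Z where "Z = (\<integral>x. gauss r x \<partial>(lborel :: (real ^ 'n) measure))"
  have l0: "0 \<le> l b" if "b \<in> B" for b
  proof -
    have "0 \<le> b \<bullet> (A *v b)" using psd by (simp add: psd_def)
    also have "\<dots> = l b" using l[OF that] nb[OF that] by (simp add: norm_eq_1)
    finally show ?thesis .
  qed
  have "(\<integral>x. (x \<bullet> (A *v x)) * gauss r x \<partial>lborel) = (\<Sum>b\<in>B. l b * (\<integral>x. (b \<bullet> x)\<^sup>2 * gauss r x \<partial>lborel))"
    unfolding eq using gauss_second_moment(1)[OF r nb] by (subst Bochner_Integration.integral_sum) auto
  also have "\<dots> \<le> (\<Sum>b\<in>B. l b * (Z / (2 * r)))"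
    unfolding Z_def using gauss_second_moment(2)[OF r nb] l0 by (intro sum_mono mult_left_mono) auto
  also have "\<dots> = trace A * Z / (2 * r)"
    using trace_spectral_matrix[OF B, of l] by (simp add: AB[symmetric] sum_distrib_right[symmetric] sum_divide_distrib[symmetric])
  finally show "(\<integral>x. (x \<bullet> (A *v x)) * gauss r x \<partial>lborel)
      \<le> trace A * (\<integral>x. gauss r x \<partial>(lborel :: (real ^ 'n) measure)) / (2 * r)" by (simp add: Z_def)
qed

definition gauss_mass :: "real \<Rightarrow> 'a::euclidean_space set \<Rightarrow> real" where
  "gauss_mass r E = (\<integral>x. indicator E x * gauss r x \<partial>lborel)"

lemma integrable_indicator_times:
  fixes f :: "'a::euclidean_space \<Rightarrow> real"
  assumes "integrable lborel f" "E \<in> sets borel"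
  shows "integrable lborel (\<lambda>x. indicator E x * f x)"
  using integrable_real_mult_indicator[of E lborel f] assms by (simp add: mult.commute)

lemma gauss_mass_UNIV_pos:
  assumes "r > 0"
  shows "0 < gauss_mass r (UNIV :: 'a::euclidean_space set)"
proof -
  have "0 \<le> gauss_mass r (UNIV :: 'a set)"
    unfolding gauss_mass_def by (intro integral_nonneg_AE AE_I2) simp
  moreover have "gauss_mass r (UNIV :: 'a set) \<noteq> 0"
  proof
    assume "gauss_mass r (UNIV :: 'a set) = 0"
    hence "AE x in (lborel :: 'a measure). gauss r x = 0"
      using integral_nonneg_eq_0_iff_AE[OF integrable_gauss[OF assms, where 'a='a]]
      by (auto simp: gauss_mass_def)
    hence "AE x in (lborel :: 'a measure). False"
    proof eventually_elim
      case (elim x)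
      thus ?case using gauss_pos[of r x] by simp
    qed
    thus False by (simp add: AE_iff_measurable[OF _ refl])
  qed
  ultimately show ?thesis by simp
qed

text \<open>Markov's inequality: under the Gaussian the mean of \<open>x \<bullet> A x\<close> is at most \<open>trace A / (2 r) \<le> m / 2\<close>, so
  at least half of the mass lies in the ellipsoid, whatever the dimension.\<close>

lemma gauss_mass_ellipsoid:
  fixes A :: "real ^ 'n ^ 'n"
  assumes A: "psd A" and r: "r > 0" and m: "m > 0" "trace A \<le> r * m"
  shows "gauss_mass r (UNIV :: (real ^ 'n) set) \<le> 2 * gauss_mass r {x. x \<bullet> (A *v x) \<le> m}"
proof -
  define E where "E = {x. x \<bullet> (A *v x) \<le> m}"
  have E[measurable]: "E \<in> sets borel" unfolding E_def by measurable
  define Z where "Z = gauss_mass r (UNIV :: (real ^ 'n) set)"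
  note int = integrable_gauss[OF r, where 'a="real ^ 'n"]
  have sym: "transpose A = A" using A by (simp add: psd_def)
  note intq = gauss_quadratic_form(1)[OF sym r]
  have Z0: "Z \<ge> 0" using gauss_mass_UNIV_pos[OF r] unfolding Z_def by (rule less_imp_le)
  have "Z = (\<integral>x. gauss r x \<partial>(lborel :: (real ^ 'n) measure))" by (simp add: Z_def gauss_mass_def)
  also have "\<dots> \<le> (\<integral>x. indicator E x * gauss r x + (1 / m) * ((x \<bullet> (A *v x)) * gauss r x) \<partial>lborel)"
  proof (rule integral_mono[OF int])
    show "integrable lborel (\<lambda>x. indicator E x * gauss r x + (1 / m) * ((x \<bullet> (A *v x)) * gauss r x))"
      using intq integrable_indicator_times[OF int E] by (intro Bochner_Integration.integrable_add integrable_mult_right) auto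
    fix x :: "real ^ 'n"
    show "gauss r x \<le> indicator E x * gauss r x + (1 / m) * ((x \<bullet> (A *v x)) * gauss r x)"
    proof (cases "x \<in> E")
      case True
      thus ?thesis using A m gauss_pos[of r x] by (simp add: psd_def)
    next
      case False
      hence "1 \<le> (x \<bullet> (A *v x)) / m" using m by (simp add: E_def)
      hence "1 * gauss r x \<le> (x \<bullet> (A *v x)) / m * gauss r x"
        using gauss_pos[of r x] by (intro mult_right_mono) auto
      thus ?thesis using False by simp
    qed
  qed
  also have "\<dots> = gauss_mass r E + (1 / m) * (\<integral>x. (x \<bullet> (A *v x)) * gauss r x \<partial>lborel)"
    unfolding gauss_mass_def using intq integrable_indicator_times[OF int E] by simp
  also have "\<dots> \<le> gauss_mass r E + (1 / m) * (trace A * Z / (2 * r))"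
    using gauss_quadratic_form(2)[OF sym r A] m by (intro add_left_mono mult_left_mono) (auto simp: Z_def gauss_mass_def)
  also have "\<dots> \<le> gauss_mass r E + (1 / m) * ((r * m) * Z / (2 * r))"
    using m r Z0 by (intro add_left_mono mult_left_mono divide_right_mono mult_right_mono) auto
  also have "\<dots> = gauss_mass r E + Z / 2" using m r by simp
  finally show ?thesis by (simp add: Z_def E_def)
qed

section \<open>The variational lower bound\<close>

lemma ennreal_integral_le_nn_integral:
  fixes f :: "'a \<Rightarrow> real"
  assumes "integrable M f"
  shows "ennreal (\<integral>x. f x \<partial>M) \<le> (\<integral>\<^sup>+x. ennreal (f x) \<partial>M)"
proof -
  have "ennreal (\<integral>x. f x \<partial>M) \<le> ennreal (\<integral>x. max 0 (f x) \<partial>M)"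
    using assms by (intro ennreal_leI integral_mono) auto
  also have "\<dots> = (\<integral>\<^sup>+x. ennreal (max 0 (f x)) \<partial>M)"
    using assms by (intro nn_integral_eq_integral[symmetric]) auto
  also have "\<dots> = (\<integral>\<^sup>+x. ennreal (f x) \<partial>M)" by (simp add: ennreal_max_0)
  finally show ?thesis .
qed

text \<open>For a direction \<open>v\<close>, compare the mixture with the truncated Gaussian on \<open>E\<close> translated by \<open>v\<close>.  The translation costs
  the relative entropy \<open>r (v \<bullet> v)\<close>, and Jensen's inequality moves the integral into the exponent.  Since
  \<open>E\<close> is symmetric, the linear terms integrate to zero, and the average of the quadratic form over
  the translate is its value at \<open>v\<close> plus a constant \<open>c\<close> independent of \<open>v\<close>.  The mixture does not depend on
  \<open>v\<close>, so a bound on it is a bound in all directions at once.\<close>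

lemma gauss_exponential_lower_bound:
  fixes D :: "real ^ 'n ^ 'n"
  assumes r: "r > 0" and D: "transpose D = D" and E[measurable]: "E \<in> sets borel"
    and T[measurable]: "T \<in> sets borel"
    and sym: "\<And>x. x \<in> E \<Longrightarrow> - x \<in> E" and sub: "\<And>x. x \<in> E \<Longrightarrow> v + x \<in> T"
    and pos: "0 < gauss_mass r E"
  defines "c \<equiv> (\<integral>x. indicator E x * ((x \<bullet> (D *v x)) * gauss r x) \<partial>lborel) / gauss_mass r E"
  shows "ennreal (gauss_mass r E * exp (a * (v \<bullet> (D *v v) + c) - r * (v \<bullet> v)))
    \<le> (\<integral>\<^sup>+x. ennreal (indicator T x * gauss r x * exp (a * (x \<bullet> (D *v x)))) \<partial>lborel)"
proof -
  define Z where "Z = gauss_mass r E"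
  define mu where "mu = a * (v \<bullet> (D *v v) + c) - r * (v \<bullet> v)"
  define w where "w = (2 * a) *\<^sub>R (D *v v) - (2 * r) *\<^sub>R v"
  \<comment> \<open>The integrand after the translation, with the exponential replaced by its tangent at the mean
    \<open>mu\<close> of the exponent; this is Jensen's inequality in pointwise form.\<close>
  define F where "F x = exp mu * (indicator E x * gauss r x) + exp mu * (indicator E x * ((w \<bullet> x) * gauss r x))
      + exp mu * a * (indicator E x * ((x \<bullet> (D *v x)) * gauss r x)) - exp mu * a * c * (indicator E x * gauss r x)" for x
  note int = integrable_gauss[OF r, where 'a="real ^ 'n"]
  note intq = gauss_quadratic_form(1)[OF D r]
  have intl: "integrable lborel (\<lambda>x. (w \<bullet> x) * gauss r x)"
  proof (rule Bochner_Integration.integrable_bound)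
    have t: "transpose (outer_self w) = outer_self w"
      by (simp add: transpose_def outer_self_def vec_eq_iff mult.commute)
    have "x \<bullet> (outer_self w *v x) = (w \<bullet> x)\<^sup>2" for x
      by (simp add: outer_self_mult power2_eq_square inner_commute)
    hence "integrable lborel (\<lambda>x. (w \<bullet> x)\<^sup>2 * gauss r x)"
      using gauss_quadratic_form(1)[OF t r] by simp
    thus "integrable lborel (\<lambda>x. gauss r x + (w \<bullet> x)\<^sup>2 * gauss r x)" using int by simp
    show "AE x in lborel. norm ((w \<bullet> x) * gauss r x) \<le> norm (gauss r x + (w \<bullet> x)\<^sup>2 * gauss r x)"
    proof (rule AE_I2)
      fix x
      define z where "z = w \<bullet> x"
      have "\<bar>z\<bar> \<le> 1 + z\<^sup>2" using zero_le_power2[of "\<bar>z\<bar> - 1"] by (simp add: power2_diff)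
      hence "\<bar>z\<bar> * gauss r x \<le> (1 + z\<^sup>2) * gauss r x"
        using gauss_pos[of r x] by (intro mult_right_mono) auto
      moreover have "0 \<le> (1 + z\<^sup>2) * gauss r x" using gauss_pos[of r x] by simp
      ultimately show "norm ((w \<bullet> x) * gauss r x) \<le> norm (gauss r x + (w \<bullet> x)\<^sup>2 * gauss r x)"
        unfolding z_def[symmetric] using gauss_pos[of r x] by (simp add: abs_mult algebra_simps)
    qed
  qed measurable
  have odd: "(\<integral>x. indicator E x * ((w \<bullet> x) * gauss r x) \<partial>lborel) = 0"
  proof (rule lborel_integral_odd)
    show "(\<lambda>x. indicator E x * ((w \<bullet> x) * gauss r x)) \<in> borel_measurable borel" by measurable
    have "(- x \<in> E) = (x \<in> E)" for x using sym[of x] sym[of "- x"] by auto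
    thus "indicator E (- x) * ((w \<bullet> - x) * gauss r (- x)) = - (indicator E x * ((w \<bullet> x) * gauss r x))" for x
      by (simp add: gauss_def indicator_def)
  qed
  note ints = integrable_indicator_times[OF int E] integrable_indicator_times[OF intq E]
    integrable_indicator_times[OF intl E]
  have intF: "integrable lborel F"
    unfolding F_def using ints by (intro Bochner_Integration.integrable_add Bochner_Integration.integrable_diff integrable_mult_right) auto
  have "(\<integral>x. F x \<partial>lborel) = exp mu * Z + exp mu * 0 + exp mu * a * (c * Z) - exp mu * a * c * Z"
  proof -
    have "c * Z = (\<integral>x. indicator E x * ((x \<bullet> (D *v x)) * gauss r x) \<partial>lborel)"
      unfolding c_def Z_def using pos by simp
    thus ?thesis unfolding F_def Z_def gauss_mass_def odd[symmetric] using ints by simp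
  qed
  hence intF': "(\<integral>x. F x \<partial>lborel) = Z * exp mu" by simp
  have pw: "F x \<le> indicator T (v + x) * gauss r (v + x) * exp (a * ((v + x) \<bullet> (D *v (v + x))))" for x
  proof (cases "x \<in> E")
    case True
    define G where "G = w \<bullet> x + a * (x \<bullet> (D *v x)) - a * c"
    have "F x = gauss r x * exp mu * (1 + G)"
      using True by (simp add: F_def G_def algebra_simps)
    also have "\<dots> \<le> gauss r x * exp mu * exp G"
      using gauss_pos[of r x] exp_ge_add_one_self[of G] by (intro mult_left_mono) auto
    also have "\<dots> = gauss r x * exp (mu + G)" by (simp add: exp_add)
    also have "mu + G = (- 2 * r * (v \<bullet> x) - r * (v \<bullet> v)) + a * ((v + x) \<bullet> (D *v (v + x)))"
    proof -
      have "v \<bullet> (D *v x) = (D *v v) \<bullet> x" by (rule symmetric_inner_swap[OF D])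
      moreover have "x \<bullet> (D *v v) = (D *v v) \<bullet> x" by (rule inner_commute)
      ultimately show ?thesis
        unfolding mu_def G_def w_def
        by (simp add: matrix_vector_right_distrib inner_add_left inner_add_right inner_diff_left algebra_simps)
    qed
    finally show ?thesis using sub[OF True] by (simp add: gauss_shift exp_add mult_ac)
  next
    case False
    thus ?thesis using gauss_pos[of r "v + x"] by (simp add: F_def)
  qed
  have "ennreal (Z * exp mu) \<le> (\<integral>\<^sup>+x. ennreal (F x) \<partial>lborel)"
    using ennreal_integral_le_nn_integral[OF intF] by (simp add: intF')
  also have "\<dots> \<le> (\<integral>\<^sup>+x. ennreal (indicator T (v + x) * gauss r (v + x) * exp (a * ((v + x) \<bullet> (D *v (v + x))))) \<partial>lborel)"
    by (intro nn_integral_mono ennreal_leI pw)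
  also have "\<dots> = (\<integral>\<^sup>+x. ennreal (indicator T x * gauss r x * exp (a * (x \<bullet> (D *v x)))) \<partial>lborel)"
    by (rule lborel_nn_integral_translate) measurable
  finally show ?thesis by (simp add: Z_def mu_def)
qed

section \<open>Uniform deviation of the empirical second moment\<close>

locale whitened_sample = prob_space M for M :: "'a measure" +
  fixes X :: "'n::finite \<Rightarrow> 'a \<Rightarrow> real ^ 'p" and S :: "real ^ 'p ^ 'p" and K :: real
  assumes X_measurable[measurable]: "\<And>i. X i \<in> borel_measurable M"
    and second_moment: "\<And>i. has_bochner_integral M (\<lambda>\<omega>. outer_self (X i \<omega>)) S"
    and K_pos: "0 < K"
    and log_sobolev_whitened: "log_sobolev (distr M (borel :: (real ^ 'p ^ 'n) measure)
             (\<lambda>\<omega>. \<chi> i. psd_sqrt (mp_inverse S) *v X i \<omega>)) K"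
begin

lemma psd_S: "psd S"
  using psd_second_moment[OF second_moment] .

text \<open>The sum of the \<open>(X i \<bullet> v)\<^sup>2\<close> is almost surely the column energy of the whitened sample along the whitening vector
  of \<open>v\<close>, and the log-Sobolev hypothesis applies to the latter.\<close>

lemma mgf_quadratic_form:
  assumes l: "2 * K * (v \<bullet> (S *v v)) * l < 1"
  shows "(\<integral>\<^sup>+\<omega>. exp (l * (\<Sum>i\<in>UNIV. (X i \<omega> \<bullet> v)\<^sup>2)) \<partial>M)
    \<le> exp (l * (real CARD('n) * (v \<bullet> (S *v v))) / (1 - 2 * K * (v \<bullet> (S *v v)) * l))"
proof -
  define B where "B = psd_sqrt (mp_inverse S)"
  define u where "u = B *v (S *v v)"
  define q where "q = v \<bullet> (S *v v)"
  have uu: "u \<bullet> u = q" and ker: "S *v (v - B *v u) = 0" and B: "transpose B = B"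
    unfolding u_def B_def q_def using whitening_vector[OF psd_S] by auto
  define Y :: "'a \<Rightarrow> real ^ 'p ^ 'n" where "Y \<omega> = (\<chi> i. B *v X i \<omega>)" for \<omega>
  have [measurable]: "(\<lambda>\<omega>. B *v X i \<omega>) \<in> borel_measurable M" for i
    by (rule borel_measurable_continuous_on[OF matrix_vector_mult_linear_continuous_on X_measurable])
  have Y[measurable]: "Y \<in> borel_measurable M"
  proof (subst borel_measurable_euclidean_space, rule ballI)
    fix b :: "real ^ 'p ^ 'n" assume "b \<in> Basis"
    then obtain i c where b: "b = axis i c" by (auto simp: Basis_vec_def)
    show "(\<lambda>\<omega>. Y \<omega> \<bullet> b) \<in> borel_measurable M"
      unfolding b inner_axis Y_def vec_lambda_beta by measurable
  qed
  define P where "P = distr M borel Y"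
  have "AE \<omega> in M. \<forall>i. X i \<omega> \<bullet> (v - B *v u) = 0"
    using inner_zero_of_kernel[OF second_moment ker] by (simp add: AE_all_countable)
  hence ae: "AE \<omega> in M. column_energy u (Y \<omega>) = (\<Sum>i\<in>UNIV. (X i \<omega> \<bullet> v)\<^sup>2)"
  proof eventually_elim
    case (elim \<omega>)
    have "Y \<omega> $ i \<bullet> u = X i \<omega> \<bullet> v" for i
    proof -
      have "Y \<omega> $ i \<bullet> u = X i \<omega> \<bullet> (B *v u)"
        unfolding Y_def using symmetric_inner_swap[OF B, of "X i \<omega>" u] by simp
      also have "\<dots> = X i \<omega> \<bullet> v" using elim by (simp add: inner_diff_right)
      finally show ?thesis .
    qed
    thus ?case by (simp add: column_energy_def)
  qed
  have "continuous_on UNIV (column_energy u :: real ^ 'p ^ 'n \<Rightarrow> real)"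
    unfolding column_energy_def[abs_def] by (intro continuous_intros)
  hence em[measurable]: "(column_energy u :: real ^ 'p ^ 'n \<Rightarrow> real) \<in> borel_measurable borel"
    by (rule borel_measurable_continuous_onI)
  have hX: "has_bochner_integral M (\<lambda>\<omega>. \<Sum>i\<in>UNIV. (X i \<omega> \<bullet> v)\<^sup>2) (\<Sum>i\<in>(UNIV::'n set). q)"
    unfolding q_def by (intro has_bochner_integral_sum second_moment_quadratic second_moment)
  have hY: "has_bochner_integral M (\<lambda>\<omega>. column_energy u (Y \<omega>)) (real CARD('n) * q)"
  proof -
    have "has_bochner_integral M (\<lambda>\<omega>. column_energy u (Y \<omega>)) (\<Sum>i\<in>(UNIV::'n set). q)"
      using hX by (subst has_bochner_integral_cong_AE[OF _ _ ae]) measurable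
    thus ?thesis by simp
  qed
  have intP: "integrable P (column_energy u)"
    unfolding P_def using hY by (subst integrable_distr_eq) (auto simp: has_bochner_integral_iff)
  have intP': "(\<integral>y. column_energy u y \<partial>P) = real CARD('n) * q"
    unfolding P_def using hY by (subst integral_distr) (auto simp: has_bochner_integral_iff)
  have "continuous_on UNIV (\<lambda>y :: real ^ 'p ^ 'n. (\<chi> i. (2 * (y $ i \<bullet> u)) *\<^sub>R u :: real ^ 'p ^ 'n))"
    by (intro continuous_intros)
  hence Gm: "(\<lambda>y :: real ^ 'p ^ 'n. (\<chi> i. (2 * (y $ i \<bullet> u)) *\<^sub>R u :: real ^ 'p ^ 'n)) \<in> borel_measurable borel"
    by (rule borel_measurable_continuous_onI)
  have "(\<integral>\<^sup>+\<omega>. exp (l * (\<Sum>i\<in>UNIV. (X i \<omega> \<bullet> v)\<^sup>2)) \<partial>M) = (\<integral>\<^sup>+\<omega>. exp (l * column_energy u (Y \<omega>)) \<partial>M)"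
    using ae by (intro nn_integral_cong_AE, eventually_elim) simp
  also have "\<dots> = (\<integral>\<^sup>+y. exp (l * column_energy u y) \<partial>P)"
    unfolding P_def by (subst nn_integral_distr) measurable
  also have "\<dots> \<le> exp (l * (\<integral>y. column_energy u y \<partial>P) / (1 - 2 * K * q * l))"
  proof (rule mgf_self_bounding[OF _ _ _ _ _ _ column_energy_gradient Gm _ intP])
    show "prob_space P" unfolding P_def by (rule prob_space_distr) measurable
    show "sets P = sets borel" by (simp add: P_def)
    show "log_sobolev P K" using log_sobolev_whitened unfolding P_def Y_def[abs_def] B_def .
    show "0 \<le> K" using K_pos by simp
    show "0 \<le> q" using uu by (metis inner_ge_zero)
    show "0 \<le> column_energy u y" for y :: "real ^ 'p ^ 'n"
      unfolding column_energy_def by (intro sum_nonneg) auto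
    show "(norm (\<chi> i. (2 * (y $ i \<bullet> u)) *\<^sub>R u :: real ^ 'p ^ 'n))\<^sup>2 \<le> 4 * q * column_energy u y"
      for y :: "real ^ 'p ^ 'n"
      using column_energy_gradient_norm[of y u] uu by simp
    show "2 * K * q * l < 1" using l by (simp add: q_def)
  qed
  finally show ?thesis unfolding intP' q_def .
qed

definition deviation :: "'a \<Rightarrow> real ^ 'p ^ 'p" where
  "deviation \<omega> = (\<Sum>i\<in>UNIV. outer_self (X i \<omega>)) - real CARD('n) *\<^sub>R S"

lemma deviation_symmetric: "transpose (deviation \<omega>) = deviation \<omega>"
proof -
  have "S $ j $ k = S $ k $ j" for j k using psd_S by (simp add: psd_def transpose_def vec_eq_iff)
  thus ?thesis by (simp add: deviation_def transpose_def outer_self_def vec_eq_iff mult.commute)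
qed

lemma deviation_quadratic:
  "v \<bullet> (deviation \<omega> *v v) = (\<Sum>i\<in>UNIV. (X i \<omega> \<bullet> v)\<^sup>2) - real CARD('n) * (v \<bullet> (S *v v))"
  by (simp add: deviation_def matrix_vector_mult_diff_rdistrib matrix_vector_mult_sum_left outer_self_mult
      scaleR_matrix_vector_assoc[symmetric] inner_diff_right inner_sum_right power2_eq_square inner_commute)

text \<open>Centring the bound on the quadratic form: with \<open>z = a (v \<bullet> S v)\<close> and \<open>n\<close> vectors, the exponent
  \<open>n z / (1 - 2 K z) - n z\<close> is of second order in \<open>z\<close>, for either sign of \<open>a\<close>.\<close>

lemma mgf_deviation:
  assumes y: "\<bar>a\<bar> * (v \<bullet> (S *v v)) \<le> y" "2 * K * y < 1"
  shows "(\<integral>\<^sup>+\<omega>. exp (a * (v \<bullet> (deviation \<omega> *v v))) \<partial>M)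
    \<le> exp (2 * K * real CARD('n) * y\<^sup>2 / (1 - 2 * K * y))"
proof -
  define n where "n = real CARD('n)"
  define k where "k = v \<bullet> (S *v v)"
  define z where "z = a * k"
  have k0: "0 \<le> k" using psd_S by (simp add: k_def psd_def)
  have zy: "\<bar>z\<bar> \<le> y" using y(1) k0 by (simp add: z_def k_def[symmetric] abs_mult)
  have Kz: "2 * K * z \<le> 2 * K * y" using zy K_pos by (intro mult_left_mono) auto
  have l: "2 * K * (v \<bullet> (S *v v)) * a < 1" using Kz y(2) by (simp add: z_def k_def[symmetric] mult_ac)
  have "(\<integral>\<^sup>+\<omega>. exp (a * (v \<bullet> (deviation \<omega> *v v))) \<partial>M)
      = (\<integral>\<^sup>+\<omega>. ennreal (exp (- n * z)) * ennreal (exp (a * (\<Sum>i\<in>UNIV. (X i \<omega> \<bullet> v)\<^sup>2))) \<partial>M)"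
    by (intro nn_integral_cong)
      (simp add: deviation_quadratic ennreal_mult[symmetric] exp_add[symmetric] n_def k_def z_def algebra_simps)
  also have "\<dots> = ennreal (exp (- n * z)) * (\<integral>\<^sup>+\<omega>. exp (a * (\<Sum>i\<in>UNIV. (X i \<omega> \<bullet> v)\<^sup>2)) \<partial>M)"
    by (rule nn_integral_cmult) measurable
  also have "\<dots> \<le> ennreal (exp (- n * z)) * ennreal (exp (a * (n * k) / (1 - 2 * K * k * a)))"
    unfolding n_def k_def
    by (intro mult_left_mono mgf_quadratic_form[OF l]) auto
  also have "\<dots> = ennreal (exp (a * (n * k) / (1 - 2 * K * k * a) - n * z))"
    by (simp add: ennreal_mult[symmetric] exp_add[symmetric])
  also have "\<dots> \<le> ennreal (exp (2 * K * n * y\<^sup>2 / (1 - 2 * K * y)))"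
  proof (intro ennreal_leI exp_le_cancel_iff[THEN iffD2])
    have d: "1 - 2 * K * z > 0" using Kz y(2) by linarith
    have "a * (n * k) / (1 - 2 * K * k * a) - n * z = n * z / (1 - 2 * K * z) - n * z"
      by (simp add: z_def mult_ac)
    also have "\<dots> = (n * z - n * z * (1 - 2 * K * z)) / (1 - 2 * K * z)"
      using d by (simp add: diff_divide_distrib)
    also have "n * z - n * z * (1 - 2 * K * z) = 2 * K * n * z\<^sup>2"
      by (simp add: right_diff_distrib power2_eq_square)
    also have "2 * K * n * z\<^sup>2 / (1 - 2 * K * z) \<le> 2 * K * n * y\<^sup>2 / (1 - 2 * K * y)"
    proof (rule frac_le)
      have "z\<^sup>2 \<le> y\<^sup>2" using zy abs_ge_zero[of z] by (metis abs_le_square_iff abs_of_nonneg order_trans)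
      thus "2 * K * n * z\<^sup>2 \<le> 2 * K * n * y\<^sup>2" using K_pos by (intro mult_left_mono) (auto simp: n_def)
    qed (use K_pos Kz y(2) in \<open>auto simp: n_def\<close>)
    finally show "a * (n * k) / (1 - 2 * K * k * a) - n * z \<le> 2 * K * n * y\<^sup>2 / (1 - 2 * K * y)" .
  qed
  finally show ?thesis by (simp add: n_def)
qed

text \<open>The exponential moment is averaged over directions \<open>x\<close> with a Gaussian weight, cut off to a set \<open>A\<close> on which
  \<open>x \<bullet> S x\<close> is bounded so that, for small \<open>a\<close>, each exponential moment is finite.\<close>

definition mixture :: "real \<Rightarrow> (real ^ 'p) set \<Rightarrow> real \<Rightarrow> 'a \<Rightarrow> ennreal" where
  "mixture r A a \<omega> = (\<integral>\<^sup>+x. ennreal (indicator A x * gauss r x * exp (a * (x \<bullet> (deviation \<omega> *v x)))) \<partial>lborel)"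

lemma mixture_joint_measurable:
  assumes [measurable]: "A \<in> sets borel"
  shows "(\<lambda>(\<omega>, x). ennreal (indicator A x * gauss r x * exp (a * (x \<bullet> (deviation \<omega> *v x)))))
    \<in> borel_measurable (M \<Otimes>\<^sub>M lborel)"
proof -
  have [measurable]: "(\<lambda>p. snd p \<bullet> (S *v snd p)) \<in> borel_measurable (M \<Otimes>\<^sub>M lborel)"
    by (rule measurable_compose[OF _ quadratic_form_measurable]) measurable
  have "(\<lambda>p. ennreal (indicator A (snd p) * gauss r (snd p) *
      exp (a * ((\<Sum>i\<in>UNIV. (X i (fst p) \<bullet> snd p)\<^sup>2) - real CARD('n) * (snd p \<bullet> (S *v snd p))))))
    \<in> borel_measurable (M \<Otimes>\<^sub>M lborel)" by measurable
  thus ?thesis by (simp add: deviation_quadratic case_prod_unfold)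
qed

lemma mixture_measurable[measurable]:
  assumes [measurable]: "A \<in> sets borel"
  shows "mixture r A a \<in> borel_measurable M"
  unfolding mixture_def
  by (rule lborel.borel_measurable_nn_integral[OF mixture_joint_measurable]) fact

lemma expectation_mixture_le:
  assumes r: "r > 0" and A[measurable]: "A \<in> sets borel"
    and y: "\<And>v. v \<in> A \<Longrightarrow> \<bar>a\<bar> * (v \<bullet> (S *v v)) \<le> y" "2 * K * y < 1"
  shows "(\<integral>\<^sup>+\<omega>. mixture r A a \<omega> \<partial>M)
    \<le> ennreal (gauss_mass r A * exp (2 * K * real CARD('n) * y\<^sup>2 / (1 - 2 * K * y)))"
proof -
  interpret P: pair_sigma_finite M lborel ..
  define e where "e = exp (2 * K * real CARD('n) * y\<^sup>2 / (1 - 2 * K * y))"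
  define g where "g x = indicator A x * gauss r x" for x :: "real ^ 'p"
  have g0: "0 \<le> g x" for x by (simp add: g_def)
  have [measurable]: "g \<in> borel_measurable borel" unfolding g_def by measurable
  have "(\<integral>\<^sup>+\<omega>. mixture r A a \<omega> \<partial>M)
      = (\<integral>\<^sup>+x. (\<integral>\<^sup>+\<omega>. ennreal (g x * exp (a * (x \<bullet> (deviation \<omega> *v x)))) \<partial>M) \<partial>lborel)"
    unfolding mixture_def g_def using mixture_joint_measurable[OF A] by (rule P.Fubini'[symmetric])
  also have "\<dots> \<le> (\<integral>\<^sup>+x. ennreal (g x) * ennreal e \<partial>lborel)"
  proof (rule nn_integral_mono)
    fix x :: "real ^ 'p"
    show "(\<integral>\<^sup>+\<omega>. ennreal (g x * exp (a * (x \<bullet> (deviation \<omega> *v x)))) \<partial>M) \<le> ennreal (g x) * ennreal e"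
    proof (cases "x \<in> A")
      case True
      have "(\<integral>\<^sup>+\<omega>. ennreal (g x * exp (a * (x \<bullet> (deviation \<omega> *v x)))) \<partial>M)
          = ennreal (g x) * (\<integral>\<^sup>+\<omega>. ennreal (exp (a * (x \<bullet> (deviation \<omega> *v x)))) \<partial>M)"
        unfolding deviation_quadratic using g0[of x]
        by (subst nn_integral_cmult[symmetric]) (auto simp: ennreal_mult)
      also have "\<dots> \<le> ennreal (g x) * ennreal e"
        unfolding e_def by (intro mult_left_mono mgf_deviation y True) auto
      finally show ?thesis .
    qed (simp add: g_def)
  qed
  also have "\<dots> = (\<integral>\<^sup>+x. ennreal (g x) \<partial>lborel) * ennreal e"
    by (rule nn_integral_multc) measurable
  also have "(\<integral>\<^sup>+x. ennreal (g x) \<partial>lborel) = ennreal (gauss_mass r A)"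
    unfolding gauss_mass_def g_def using integrable_indicator_times[OF integrable_gauss[OF r] A]
    by (intro nn_integral_eq_integral) auto
  also have "ennreal (gauss_mass r A) * ennreal e = ennreal (gauss_mass r A * e)"
    by (intro ennreal_mult[symmetric]) (auto simp: gauss_mass_def e_def intro!: integral_nonneg_AE AE_I2)
  finally show ?thesis by (simp add: e_def)
qed

text \<open>Four mixtures are bounded at once by Markov's inequality: exponents \<open>\<plusminus>5/4 l\<close> on the ellipsoid \<open>T\<close> and
  \<open>\<plusminus>5 l\<close> on the smaller ellipsoid \<open>E\<close>.  Off the exceptional event the variational lower bound holds for every
  direction \<open>v\<close> at once.  On \<open>T\<close> it controls \<open>q + k\<close>, where \<open>q\<close> is the deviation in direction \<open>v\<close> and \<open>k\<close> is the average
  of the deviation over the truncated Gaussian; on \<open>E\<close>, with centre \<open>0\<close>, it controls \<open>-k\<close>, and \<open>k\<close> is eliminated between the two.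

  The exponents are chosen so that both mixtures have the same moment bound: \<open>T\<close> contains all translates
  \<open>v + E\<close> with \<open>norm v \<le> 1\<close> once its level is \<open>4 m\<close>, and \<open>5/4 l \<cdot> 4 m = 5 l \<cdot> m\<close>.\<close>

lemma uniform_deviation:
  fixes m r l t :: real
  assumes m: "m > 0" and r: "r > 0" and tr: "trace S \<le> r * m" and Sm: "op_norm S \<le> m"
    and l: "l > 0" and Ky: "2 * K * (5 * l * m) < 1"
  shows "\<exists>G\<in>sets M. 1 - exp (- t) \<le> prob G \<and> (\<forall>\<omega>\<in>G. \<forall>v. norm v \<le> 1 \<longrightarrow>
    l * \<bar>v \<bullet> (deviation \<omega> *v v)\<bar>
      \<le> 4 / 5 * r + ln 8 + 2 * K * real CARD('n) * (5 * l * m)\<^sup>2 / (1 - 2 * K * (5 * l * m)) + t)"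
proof -
  define y where "y = 5 * l * m"
  define psi where "psi = 2 * K * real CARD('n) * y\<^sup>2 / (1 - 2 * K * y)"
  define E where "E = {x. x \<bullet> (S *v x) \<le> m}"
  define T where "T = {x. x \<bullet> (S *v x) \<le> 4 * m}"
  have [measurable]: "E \<in> sets borel" "T \<in> sets borel" unfolding E_def T_def by measurable
  define Z where "Z = gauss_mass r E"
  define Z1 where "Z1 = gauss_mass r (UNIV :: (real ^ 'p) set)"
  have ZZ: "Z1 \<le> 2 * Z" unfolding Z_def Z1_def E_def by (rule gauss_mass_ellipsoid[OF psd_S r m tr])
  have Zpos: "0 < Z" using ZZ gauss_mass_UNIV_pos[OF r, where 'a="real ^ 'p"] by (simp add: Z1_def)
  have mass: "gauss_mass r A \<le> 2 * Z" if [measurable]: "A \<in> sets borel" for A :: "(real ^ 'p) set"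
  proof -
    note int = integrable_gauss[OF r, where 'a="real ^ 'p"]
    have "gauss_mass r A \<le> Z1" unfolding Z1_def gauss_mass_def
      by (intro integral_mono integrable_indicator_times[OF int]) (auto simp: indicator_def)
    thus ?thesis using ZZ by simp
  qed
  have EM: "(\<integral>\<^sup>+\<omega>. mixture r A a \<omega> \<partial>M) \<le> ennreal (2 * Z * exp psi)"
    if [measurable]: "A \<in> sets borel" and "\<And>v. v \<in> A \<Longrightarrow> \<bar>a\<bar> * (v \<bullet> (S *v v)) \<le> y" for A a
  proof -
    have "(\<integral>\<^sup>+\<omega>. mixture r A a \<omega> \<partial>M) \<le> ennreal (gauss_mass r A * exp psi)"
      unfolding psi_def using that Ky by (intro expectation_mixture_le r) (auto simp: y_def)
    also have "\<dots> \<le> ennreal (2 * Z * exp psi)"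
      using mass[OF that(1)] by (intro ennreal_leI mult_right_mono) auto
    finally show ?thesis .
  qed
  define U where "U \<omega> = mixture r T (5 / 4 * l) \<omega> + mixture r T (- (5 / 4 * l)) \<omega>
    + mixture r E (5 * l) \<omega> + mixture r E (- (5 * l)) \<omega>" for \<omega>
  have [measurable]: "U \<in> borel_measurable M" unfolding U_def by measurable
  have bT: "\<bar>a\<bar> * (v \<bullet> (S *v v)) \<le> y" if "v \<in> T" "\<bar>a\<bar> = 5 / 4 * l" for v a
  proof -
    have "5 / 4 * l * (v \<bullet> (S *v v)) \<le> 5 / 4 * l * (4 * m)"
      using that(1) l by (intro mult_left_mono) (auto simp: T_def)
    thus ?thesis unfolding that(2) y_def by simp
  qed
  have bE: "\<bar>a\<bar> * (v \<bullet> (S *v v)) \<le> y" if "v \<in> E" "\<bar>a\<bar> = 5 * l" for v a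
  proof -
    have "5 * l * (v \<bullet> (S *v v)) \<le> 5 * l * m"
      using that(1) l by (intro mult_left_mono) (auto simp: E_def)
    thus ?thesis unfolding that(2) y_def by simp
  qed
  have EU: "(\<integral>\<^sup>+\<omega>. U \<omega> \<partial>M) \<le> ennreal (8 * Z * exp psi)"
  proof -
    have "(\<integral>\<^sup>+\<omega>. U \<omega> \<partial>M) = (\<integral>\<^sup>+\<omega>. mixture r T (5 / 4 * l) \<omega> \<partial>M) + (\<integral>\<^sup>+\<omega>. mixture r T (- (5 / 4 * l)) \<omega> \<partial>M)
        + (\<integral>\<^sup>+\<omega>. mixture r E (5 * l) \<omega> \<partial>M) + (\<integral>\<^sup>+\<omega>. mixture r E (- (5 * l)) \<omega> \<partial>M)"
      unfolding U_def by (simp add: nn_integral_add)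
    also have "\<dots> \<le> ennreal (2 * Z * exp psi) + ennreal (2 * Z * exp psi)
        + ennreal (2 * Z * exp psi) + ennreal (2 * Z * exp psi)"
      using l by (intro add_mono EM bT bE) auto
    also have "\<dots> = ennreal (8 * Z * exp psi)" using Zpos by (simp add: ennreal_plus[symmetric] del: ennreal_plus)
    finally show ?thesis .
  qed
  define c where "c = 8 * Z * exp (psi + t)"
  have c: "c > 0" using Zpos by (simp add: c_def)
  define bad where "bad = {\<omega> \<in> space M. 1 \<le> ennreal (1 / c) * U \<omega>}"
  have bad[measurable]: "bad \<in> sets M" unfolding bad_def by measurable
  have "emeasure M bad \<le> ennreal (1 / c) * (\<integral>\<^sup>+\<omega>. U \<omega> * indicator (space M) \<omega> \<partial>M)"
    unfolding bad_def by (rule nn_integral_Markov_inequality) auto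
  also have "(\<integral>\<^sup>+\<omega>. U \<omega> * indicator (space M) \<omega> \<partial>M) = (\<integral>\<^sup>+\<omega>. U \<omega> \<partial>M)"
    by (intro nn_integral_cong) simp
  also have "ennreal (1 / c) * (\<integral>\<^sup>+\<omega>. U \<omega> \<partial>M) \<le> ennreal (1 / c) * ennreal (8 * Z * exp psi)"
    by (intro mult_left_mono EU) simp
  also have "\<dots> = ennreal (exp (- t))"
    using Zpos c by (simp add: ennreal_mult[symmetric] c_def exp_add exp_minus field_simps)
  finally have "prob bad \<le> exp (- t)" by (simp add: emeasure_eq_measure)
  hence pG: "1 - exp (- t) \<le> prob (space M - bad)" using bad by (subst prob_compl) auto
  have main: "l * \<bar>v \<bullet> (deviation \<omega> *v v)\<bar> \<le> 4 / 5 * r + ln 8 + psi + t"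
    if om: "\<omega> \<in> space M - bad" and v: "norm v \<le> 1" for \<omega> v
  proof -
    have U1: "ennreal (1 / c) * U \<omega> < 1" using om by (auto simp: bad_def)
    have upper: "z \<le> ln 8 + psi + t" if "ennreal (Z * exp z) \<le> U \<omega>" for z
    proof -
      have "ennreal (1 / c) * ennreal (Z * exp z) \<le> ennreal (1 / c) * U \<omega>"
        using that by (intro mult_left_mono) auto
      also have "\<dots> < 1" by (rule U1)
      finally have "ennreal (1 / c * (Z * exp z)) < 1"
        using c Zpos by (subst ennreal_mult) auto
      hence "1 / c * (Z * exp z) < 1" by (simp add: ennreal_less_one_iff)
      hence "Z * exp z < c" using c by (simp add: pos_divide_less_eq)
      also have "c = Z * (8 * exp (psi + t))" by (simp add: c_def)
      finally have "Z * exp z < Z * (8 * exp (psi + t))" .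
      hence "exp z < 8 * exp (psi + t)" using Zpos by simp
      also have "8 * exp (psi + t) = exp (ln 8 + psi + t)" by (simp add: exp_add)
      finally show ?thesis by simp
    qed
    define k where "k = (\<integral>x. indicator E x * ((x \<bullet> (deviation \<omega> *v x)) * gauss r x) \<partial>lborel) / Z"
    have Esym: "- x \<in> E" if "x \<in> E" for x
      using that by (simp add: E_def vec.neg)
    have ET: "v + x \<in> T" if "x \<in> E" for x
    proof -
      have "0 \<le> (v - x) \<bullet> (S *v (v - x))" using psd_S by (simp add: psd_def)
      moreover have "(v + x) \<bullet> (S *v (v + x)) + (v - x) \<bullet> (S *v (v - x)) = 2 * (v \<bullet> (S *v v)) + 2 * (x \<bullet> (S *v x))"
        by (simp add: matrix_vector_right_distrib matrix_vector_mult_diff_distrib inner_add_left inner_add_right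
            inner_diff_left inner_diff_right)
      moreover have "v \<bullet> (S *v v) \<le> m"
      proof -
        have "v \<bullet> (S *v v) \<le> op_norm S * (v \<bullet> v)" by (rule quadratic_form_le_op_norm)
        also have "\<dots> \<le> m * 1"
          using Sm v m by (intro mult_mono) (auto simp: dot_square_norm power_le_one)
        finally show ?thesis by simp
      qed
      ultimately show ?thesis using that by (simp add: T_def E_def)
    qed
    have lowT: "ennreal (Z * exp (a * (v \<bullet> (deviation \<omega> *v v) + k) - r * (v \<bullet> v))) \<le> mixture r T a \<omega>" for a
      unfolding mixture_def Z_def k_def
      by (rule gauss_exponential_lower_bound[OF r deviation_symmetric _ _ Esym ET])
        (use Zpos in \<open>simp_all add: Z_def\<close>)
    have lowE: "ennreal (Z * exp (a * k)) \<le> mixture r E a \<omega>" for a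
    proof -
      have "ennreal (Z * exp (a * (0 \<bullet> (deviation \<omega> *v 0) + k) - r * (0 \<bullet> (0 :: real ^ 'p)))) \<le> mixture r E a \<omega>"
        unfolding mixture_def Z_def k_def
        by (rule gauss_exponential_lower_bound[OF r deviation_symmetric _ _ Esym])
          (use Zpos in \<open>simp_all add: Z_def\<close>)
      thus ?thesis by simp
    qed
    have mU: "mixture r T (5 / 4 * l) \<omega> \<le> U \<omega>" "mixture r T (- (5 / 4 * l)) \<omega> \<le> U \<omega>"
        "mixture r E (5 * l) \<omega> \<le> U \<omega>" "mixture r E (- (5 * l)) \<omega> \<le> U \<omega>"
      unfolding U_def by (auto simp: add.assoc intro: add_increasing add_increasing2)
    define q where "q = v \<bullet> (deviation \<omega> *v v)"
    have vv: "r * (v \<bullet> v) \<le> r" using v r by (simp add: dot_square_norm power_le_one)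
    have 1: "5 / 4 * l * (q + k) - r * (v \<bullet> v) \<le> ln 8 + psi + t"
      and 2: "- (5 / 4 * l) * (q + k) - r * (v \<bullet> v) \<le> ln 8 + psi + t"
      and 3: "5 * l * k \<le> ln 8 + psi + t" and 4: "- (5 * l) * k \<le> ln 8 + psi + t"
      unfolding q_def using upper order_trans[OF lowT mU(1)] order_trans[OF lowT mU(2)]
        order_trans[OF lowE mU(3)] order_trans[OF lowE mU(4)] by blast+
    have "l * q \<le> 4 / 5 * r + ln 8 + psi + t"
    proof -
      \<comment> \<open>The weights 4/5 and 1/5 cancel \<open>k\<close>.\<close>
      have "l * q = 4 / 5 * (5 / 4 * l * (q + k)) + 1 / 5 * (- (5 * l) * k)" by (simp add: algebra_simps)
      thus ?thesis using 1 4 vv by linarith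
    qed
    moreover have "l * (- q) \<le> 4 / 5 * r + ln 8 + psi + t"
    proof -
      have "l * (- q) = 4 / 5 * (- (5 / 4 * l) * (q + k)) + 1 / 5 * (5 * l * k)" by (simp add: algebra_simps)
      thus ?thesis using 2 3 vv by linarith
    qed
    ultimately show ?thesis unfolding q_def[symmetric] by (cases "q \<ge> 0") auto
  qed
  show ?thesis
    using pG main bad unfolding psi_def y_def by (intro bexI[of _ "space M - bad"]) auto
qed

lemma degenerate_deviation:
  assumes "op_norm S = 0"
  shows "AE \<omega> in M. deviation \<omega> = 0"
proof -
  have S0: "S *v v = 0" for v using op_norm_bound[of S v] assms by simp
  hence "S = 0" by (simp add: matrix_eq)
  have "AE \<omega> in M. \<forall>i j. X i \<omega> \<bullet> axis j 1 = 0"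
    using inner_zero_of_kernel[OF second_moment S0] by (simp add: AE_all_countable)
  thus ?thesis
  proof eventually_elim
    case (elim \<omega>)
    hence "outer_self (X i \<omega>) = 0" for i by (simp add: outer_self_def vec_eq_iff inner_axis)
    thus ?case unfolding deviation_def using \<open>S = 0\<close> by simp
  qed
qed

end

theorem theorem1:
  fixes M :: "'a measure"
    and X :: "'n::finite \<Rightarrow> 'a \<Rightarrow> real ^ 'p"
    and Sigma :: "real ^ 'p ^ 'p"
    and K t :: real
  assumes "prob_space M"
    and "\<And>i. X i \<in> borel_measurable M"
    and "\<And>i. has_bochner_integral M (\<lambda>\<omega>. outer_self (X i \<omega>)) Sigma"
    and "K > 0"
    and "log_sobolev
           (distr M (borel :: (real ^ 'p ^ 'n) measure)
             (\<lambda>\<omega>. \<chi> i. psd_sqrt (mp_inverse Sigma) *v X i \<omega>)) K"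
    and "t \<ge> 0"
    and "real CARD('n) \<ge> 2 * K * (9 * eff_rank Sigma + 4 * t)"
  shows "measure M {\<omega> \<in> space M.
            op_norm ((1 / real CARD('n)) *\<^sub>R (\<Sum>i\<in>UNIV. outer_self (X i \<omega>)) - Sigma)
              \<le> 12 * sqrt K * op_norm Sigma
                  * sqrt ((9 * eff_rank Sigma + 4 * t) / real CARD('n))}
         \<ge> 1 - exp (- t)"
proof -
  interpret whitened_sample M X Sigma K
    using assms by (simp add: whitened_sample_def whitened_sample_axioms_def)
  define n where "n = real CARD('n)"
  define m where "m = op_norm Sigma"
  define r where "r = eff_rank Sigma"
  define x where "x = 9 * r + 4 * t"
  define R where "R = 12 * sqrt K * m * sqrt (x / n)"
  have n: "n > 0" by (simp add: n_def)
  have dev: "(1 / n) *\<^sub>R (\<Sum>i\<in>UNIV. outer_self (X i \<omega>)) - Sigma = (1 / n) *\<^sub>R deviation \<omega>" for \<omega>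
    using n by (simp add: deviation_def n_def scaleR_diff_right)
  define good where "good = {\<omega> \<in> space M. op_norm ((1 / n) *\<^sub>R deviation \<omega>) \<le> R}"
  have "continuous_on UNIV (outer_self :: real ^ 'p \<Rightarrow> real ^ 'p ^ 'p)"
    unfolding outer_self_def[abs_def] by (intro continuous_intros)
  hence [measurable]: "(\<lambda>\<omega>. outer_self (X i \<omega>)) \<in> borel_measurable M" for i
    by (intro measurable_compose[OF X_measurable] borel_measurable_continuous_onI)
  have "(\<lambda>\<omega>. (1 / n) *\<^sub>R deviation \<omega>) \<in> borel_measurable M" unfolding deviation_def by measurable
  hence good[measurable]: "good \<in> sets M" unfolding good_def by (rule op_norm_le_measurable)
  have "1 - exp (- t) \<le> prob good"
  proof (cases "m > 0")
    case False
    hence m0: "op_norm Sigma = 0" using op_norm_nonneg[of Sigma] by (simp add: m_def)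
    have "AE \<omega> in M. op_norm ((1 / n) *\<^sub>R deviation \<omega>) \<le> R"
      using degenerate_deviation[OF m0]
    proof eventually_elim
      case (elim \<omega>)
      have "op_norm (0 :: real ^ 'p ^ 'p) = 0" by (simp add: op_norm_def onorm_zero)
      thus ?case using elim m0 by (simp add: R_def m_def)
    qed
    hence "prob good = 1" unfolding good_def using good[unfolded good_def] by (simp add: prob_Collect_eq_1)
    thus ?thesis by simp
  next
    case True
    have r_eq: "r = trace Sigma / m" using True by (simp add: r_def eff_rank_def m_def)
    have tr: "trace Sigma = r * m" using True by (simp add: r_eq)
    have r1: "1 \<le> r" using op_norm_le_trace[OF psd_S] True by (simp add: r_eq m_def)
    have x9: "x \<ge> 9" using r1 assms(6) by (simp add: x_def)
    define s where "s = sqrt (K * x / n)"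
    have s2: "s\<^sup>2 = K * x / n" using K_pos x9 n by (simp add: s_def)
    have s0: "s > 0" using K_pos x9 n by (simp add: s_def)
    have "s\<^sup>2 \<le> 1 / 2" using assms(7) n unfolding s2 by (simp add: x_def r_def n_def field_simps)
    hence s1: "s \<le> 1" using s0 by (intro power2_le_imp_le[of s 1]) auto
    \<comment> \<open>Up to the factor 20, \<open>l\<close> balances the moment term, which grows like \<open>n K l\<^sup>2 m\<^sup>2\<close>, against the
      complexity term \<open>x\<close>.\<close>
    define l where "l = s / (20 * K * m)"
    have l: "l > 0" using s0 K_pos True by (simp add: l_def)
    have y: "5 * l * m = s / (4 * K)" using True K_pos by (simp add: l_def)
    have Ky: "2 * K * (5 * l * m) = s / 2" unfolding y using K_pos by simp
    have "\<exists>G\<in>sets M. 1 - exp (- t) \<le> prob G \<and> (\<forall>\<omega>\<in>G. \<forall>v. norm v \<le> 1 \<longrightarrow>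
      l * \<bar>v \<bullet> (deviation \<omega> *v v)\<bar>
        \<le> 4 / 5 * r + ln 8 + 2 * K * real CARD('n) * (5 * l * m)\<^sup>2 / (1 - 2 * K * (5 * l * m)) + t)"
      using True r1 tr l s1 by (intro uniform_deviation) (auto simp: Ky m_def[symmetric])
    then obtain G where G: "G \<in> sets M" "1 - exp (- t) \<le> prob G"
      and dv: "\<And>\<omega> v. \<omega> \<in> G \<Longrightarrow> norm v \<le> 1 \<Longrightarrow> l * \<bar>v \<bullet> (deviation \<omega> *v v)\<bar>
        \<le> 4 / 5 * r + ln 8 + 2 * K * n * (5 * l * m)\<^sup>2 / (1 - 2 * K * (5 * l * m)) + t"
      unfolding n_def by blast
    have psi: "2 * K * n * (5 * l * m)\<^sup>2 / (1 - 2 * K * (5 * l * m)) \<le> x / 4"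
    proof -
      have num: "2 * K * n * (5 * l * m)\<^sup>2 = x / 8"
        unfolding y power_divide s2 using K_pos n by (simp add: power2_eq_square field_simps)
      have "x / 8 / (1 - s / 2) \<le> x / 8 / (1 / 2)"
        using s1 x9 by (intro divide_left_mono) auto
      also have "\<dots> = x / 4" by simp
      finally show ?thesis unfolding Ky num .
    qed
    \<comment> \<open>As \<open>r \<ge> 1\<close>, the constant \<open>ln 8\<close> is absorbed into the multiple of \<open>r\<close> inside \<open>x\<close>.\<close>
    have ln8: "ln 8 \<le> (25 / 12 :: real)"
    proof -
      have "ln (8 :: real) = 3 * ln 2" using ln_realpow[of 2 3] by simp
      thus ?thesis using ln2_le_25_over_36 by simp
    qed
    have "G \<subseteq> good"
    proof
      fix \<omega> assume w: "\<omega> \<in> G"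
      have "op_norm ((1 / n) *\<^sub>R deviation \<omega>) \<le> R"
      proof (rule op_norm_le_quadratic_form)
        show "transpose ((1 / n) *\<^sub>R deviation \<omega>) = (1 / n) *\<^sub>R deviation \<omega>"
          using deviation_symmetric[of \<omega>] by (simp add: transpose_def vec_eq_iff)
        fix v :: "real ^ 'p" assume v: "norm v \<le> 1"
        define q where "q = \<bar>v \<bullet> (deviation \<omega> *v v)\<bar>"
        have "l * q \<le> 4 / 5 * r + ln 8 + x / 4 + t"
          unfolding q_def
          by (intro order_trans[OF dv[OF w v]] add_right_mono add_left_mono psi)
        hence "l * q \<le> 3 / 5 * x"
          using ln8 r1 assms(6) by (simp add: x_def field_simps)
        hence "q * l \<le> 3 / 5 * x" by (simp only: mult.commute)
        hence "q \<le> 3 / 5 * x / l" using l by (simp only: pos_le_divide_eq)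
        hence "q / n \<le> 3 / 5 * x / l / n" using n by (intro divide_right_mono) auto
        also have "\<dots> = 12 * m * (K * x / n) / s"
          using s0 K_pos True n by (simp add: l_def field_simps)
        also have "\<dots> = 12 * m * s" unfolding s2[symmetric] using s0 by (simp add: power2_eq_square)
        also have "\<dots> = R" by (simp add: R_def s_def real_sqrt_mult[symmetric] mult_ac)
        finally show "\<bar>v \<bullet> (((1 / n) *\<^sub>R deviation \<omega>) *v v)\<bar> \<le> R"
          using n by (simp add: q_def scaleR_matrix_vector_assoc[symmetric] abs_mult)
      qed
      thus "\<omega> \<in> good" using w sets.sets_into_space[OF G(1)] by (auto simp: good_def)
    qed
    hence "prob G \<le> prob good" using good by (intro finite_measure_mono)
    thus ?thesis using G(2) by simp
  qed
  thus ?thesis unfolding good_def R_def x_def m_def r_def dev[symmetric] unfolding n_def .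
qed

end
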